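(* Let $\Omega\subset\mathbb{R}^2$ be a bounded, connected, simply connected domain with piecewise smooth boundary. Let $\varphi:\Phi\to\Phi$ be the billiard map, $\nu$ the Liouville measure, and $\rho:\Phi\to\mathbb{R}$ the rotation number function. (1) Let $X\subset[0,1]$ be measurable and $1-X=\{1-x:x\in X\}$. Then $\rho^{-1}(X)$ and $\rho^{-1}(1-X)$ are measurable subsets of $\Phi$ and $\nu(\rho^{-1}(X))=\nu(\rho^{-1}(1-X))$. (2) $\displaystyle\frac{\int_\Phi\rho(z)\,d\nu(z)}{\nu(\Phi)}=\frac12.$ (3) If the billiard in $\Omega$ is ergodic (with respect to $\nu$), then $\rho(z)=1/2$ for $\nu$-almost all $z$.
   Context: $|\partial\Omega|$ denotes the perimeter of $\partial\Omega$, a simple closed curve. Choose a reference point on $\partial\Omega$, orient $\partial\Omega$ positively and parametrize it by arclength $s$, identifying $\partial\Omega$ with $\mathbb{R}/|\partial\Omega|\mathbb{Z}$. The phase space $\Phi$ consists of pairs $(s,\theta)$, $0\le s\le|\partial\Omega|$, $0\le\theta\le\pi$, where $\theta$ is the angle between a ray leaving the boundary point with coordinate $s$ into $\Omega$ and the positively oriented tangent there. The billiard map $\varphi$ sends $(s,\theta)$ to the phase point at the next boundary hit of that ray, with direction given by the law of reflection. The Liouville measure is $d\nu=\sin\theta\,ds\,d\theta$, $\nu(\Phi)=2|\partial\Omega|$. The footpoint $p(z)$ of $z=(s,\theta)$ is the boundary point with coordinate $s$. For $x_1,x_2\in\partial\Omega$ with coordinates $s_1,s_2\in[0,|\partial\Omega|)$,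 $\xi(x_1,x_2)$ is the unique $0\le\xi<|\partial\Omega|$ with $s_1+\xi=s_2$ or $s_1+\xi=s_2+|\partial\Omega|$; set $\xi(z)=\xi(p(z),p(\varphi(z)))$. The footpoint gain is $\upsilon(z)=\lim_{n\to\infty}\frac1n\sum_{k=0}^{n-1}\xi(\varphi^k(z))$ (defined where the limit exists, which is $\nu$-a.e.), and the rotation number function is $\rho(z)=\upsilon(z)/|\partial\Omega|$. *)

theory Defs
  imports "HOL-Complex_Analysis.Winding_Numbers"
begin

(* The plane R^2 is identified with the complex numbers. *)

definition smooth_real_fun :: "(real \<Rightarrow> complex) \<Rightarrow> bool" where
  "smooth_real_fun g \<longleftrightarrow>
     (\<exists>D :: nat \<Rightarrow> real \<Rightarrow> complex. D 0 = g \<and>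
        (\<forall>n x. (D n has_vector_derivative D (Suc n) x) (at x)))"

definition piecewise_smooth_arclength :: "(real \<Rightarrow> complex) \<Rightarrow> real \<Rightarrow> bool" where
  "piecewise_smooth_arclength \<gamma> L \<longleftrightarrow> L > 0 \<and> (\<forall>s. \<gamma> (s + L) = \<gamma> s) \<and>
     (\<exists>S. finite S \<and> 0 \<in> S \<and> L \<in> S \<and> S \<subseteq> {0..L} \<and>
        (\<forall>a\<in>S. \<forall>b\<in>S. a < b \<and> {a<..<b} \<inter> S = {} \<longrightarrow>
           (\<exists>g. smooth_real_fun g \<and>
                (\<forall>s\<in>{a..b}. \<gamma> s = g s \<and> norm (vector_derivative g (at s)) = 1))))"

definition boundary_path :: "(real \<Rightarrow> complex) \<Rightarrow> real \<Rightarrow> real \<Rightarrow> complex" where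
  "boundary_path \<gamma> L = (\<lambda>t. \<gamma> (L * t))"

text \<open>Positively oriented unit tangent at arclength coordinate s (right derivative,
  which is the tangent of the piece starting at s at a corner).\<close>
definition tangent :: "(real \<Rightarrow> complex) \<Rightarrow> real \<Rightarrow> complex" where
  "tangent \<gamma> s = vector_derivative \<gamma> (at s within {s..})"

definition phase_space :: "real \<Rightarrow> (real \<times> real) set" where
  "phase_space L = {0..L} \<times> {0..pi}"

text \<open>Billiard map: follow the ray leaving gamma s with angle theta to the tangent
  to the next boundary hit; the new angle is given by the law of reflection
  (reflected direction r = T'^2 * conj d, new angle = arg (r / T')).\<close>
definition billiard_map :: "(real \<Rightarrow> complex) \<Rightarrow> real \<Rightarrow> real \<times> real \<Rightarrow> real \<times> real" where
  "billiard_map \<gamma> L z =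
     (let s = fst z; \<theta> = snd z;
          d = tangent \<gamma> s * cis \<theta>;
          t = Inf {t. t > 0 \<and> \<gamma> s + of_real t * d \<in> \<gamma> ` {0..L}};
          p = \<gamma> s + of_real t * d;
          s' = (THE s'. s' \<in> {0..<L} \<and> \<gamma> s' = p);
          T' = tangent \<gamma> s'
      in (s', Arg (T' * cnj d)))"

definition liouville :: "real \<Rightarrow> (real \<times> real) measure" where
  "liouville L = density (restrict_space lebesgue (phase_space L)) (\<lambda>z. ennreal (sin (snd z)))"

text \<open>Footpoint gain xi(z): the unique 0 <= xi < L with s(z) + xi = s(phi z) mod L.\<close>
definition footpoint_step :: "(real \<Rightarrow> complex) \<Rightarrow> real \<Rightarrow> real \<times> real \<Rightarrow> real" where
  "footpoint_step \<gamma> L z = L * frac ((fst (billiard_map \<gamma> L z) - fst z) / L)"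

definition gain_average :: "(real \<Rightarrow> complex) \<Rightarrow> real \<Rightarrow> real \<times> real \<Rightarrow> nat \<Rightarrow> real" where
  "gain_average \<gamma> L z n =
     (\<Sum>k<Suc n. footpoint_step \<gamma> L ((billiard_map \<gamma> L ^^ k) z)) / real (Suc n)"

text \<open>Rotation number rho = upsilon / L, where upsilon is the limit of the averages
  (defined where the limit exists; set to 0 elsewhere, a null set).\<close>
definition rotation_number :: "(real \<Rightarrow> complex) \<Rightarrow> real \<Rightarrow> real \<times> real \<Rightarrow> real" where
  "rotation_number \<gamma> L z =
     (if convergent (gain_average \<gamma> L z) then lim (gain_average \<gamma> L z) / L else 0)"

definition ergodic :: "'a measure \<Rightarrow> ('a \<Rightarrow> 'a) \<Rightarrow> bool" where
  "ergodic M f \<longleftrightarrow>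
     (\<forall>A \<in> sets M. f -` A \<inter> space M = A \<longrightarrow>
        emeasure M A = 0 \<or> emeasure M (space M - A) = 0)"

end

theory Submission
  imports Defs
begin

text \<open>
  Fix a direction \<open>d\<close>. Along almost every line parallel to \<open>d\<close> the boundary is crossed transversally at
  finitely many smooth points, at which the line alternately enters and leaves the table, and the
  billiard map sends each entry to the following exit. Disintegrating the Liouville measure over the
  lines, which only needs the one-dimensional area formula for the height \<open>Im (cnj d * \<gamma> s)\<close>, turns this
  bijection into invariance of the measure; no differentiability of the billiard map is used. That the
  table lies to the left of the boundary comes from the jump of the winding number across the curve.

  Reversing directions, \<open>I (s, \<theta>) = (s, \<pi> - \<theta>)\<close>, preserves the measure, satisfies \<open>\<phi> \<circ> I \<circ> \<phi> = I\<close> almost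
  everywhere and replaces the step \<open>\<xi>\<close> by \<open>|\<partial>\<Omega>| - \<xi>\<close>. Hence ergodic averages along reversed orbit
  segments are \<open>1 - \<close> those along the segments, and with Birkhoff's theorem \<open>\<rho> \<circ> I = 1 - \<rho>\<close> almost everywhere.
\<close>

section \<open>The ergodic theorem and time reversal\<close>

text \<open>The usual argument computes the Jacobian of the billiard map and needs control of the
  set where the map fails to be smooth. A smooth boundary piece may touch parallel lines at
  infinitely many points or along segments, and rays may end in corners, so that set can be
  complicated. With the direction fixed, only the values of one real function at its critical points
  and at the corners are bad, and they form a null set by Sard's lemma in dimension one. The factor
  \<open>sin \<theta>\<close> is the absolute slope of the height at the footpoint. Hence the
  Liouville measure is counting measure on the crossings of a line, integrated over heights and
  directions. A direction can be read at a footpoint as the outgoing or as the incoming one; both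
  readings give the same measure, and the bijection of entries with exits turns one into the other.
  Since \<open>billiard_map\<close> only looks for the first boundary hit and does not mention the
  table, it has to be proved that the rays that carry weight run inside it; otherwise entries and
  exits could not be matched.\<close>

definition birkhoff_avg :: "('a \<Rightarrow> 'a) \<Rightarrow> ('a \<Rightarrow> real) \<Rightarrow> nat \<Rightarrow> 'a \<Rightarrow> real" where
  "birkhoff_avg T f n x = (\<Sum>k<Suc n. f ((T ^^ k) x)) / real (Suc n)"

locale measure_preserving_map = finite_measure M for M :: "'a measure" +
  fixes T :: "'a \<Rightarrow> 'a"
  assumes T_meas[measurable]: "T \<in> measurable M M" and T_distr: "distr M M T = M"
begin

lemma pow_meas[measurable]: "(T ^^ n) \<in> measurable M M"
  by (induction n) (auto simp: id_def)

lemma integral_comp: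
  fixes g :: "'a \<Rightarrow> real"
  assumes [measurable]: "g \<in> borel_measurable M"
  shows "(\<integral>x. g (T x) \<partial>M) = (\<integral>x. g x \<partial>M)"
  using integral_distr[OF T_meas assms] by (simp add: T_distr)

lemma AE_comp: "AE x in M. P x \<Longrightarrow> AE x in M. P (T x)"
  using AE_distrD[OF T_meas, of P] unfolding T_distr .

lemma AE_iterates:
  assumes "AE x in M. P x" shows "AE x in M. \<forall>k. P ((T ^^ k) x)"
proof -
  have "AE x in M. P ((T ^^ k) x)" for k
  proof (induction k)
    case (Suc k)
    from AE_comp[OF this] show ?case by (simp add: funpow_swap1)
  qed (use assms in simp)
  then show ?thesis by (simp add: AE_all_countable)
qed

lemma pow_preserving: "measure_preserving_map M (T ^^ n)"
proof (induction n)
  case 0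
  then show ?case by unfold_locales (auto simp: id_def distr_id)
next
  case (Suc n)
  interpret N: measure_preserving_map M "T ^^ n" by fact
  have "distr M M (T \<circ> (T ^^ n)) = distr (distr M M (T ^^ n)) M T"
    by (subst distr_distr) auto
  also have "\<dots> = M" by (simp add: N.T_distr T_distr)
  finally show ?case by unfold_locales (auto simp: comp_def)
qed

lemma birkhoff_avg_meas[measurable]:
  assumes [measurable]: "f \<in> borel_measurable M"
  shows "birkhoff_avg T f n \<in> borel_measurable M"
  unfolding birkhoff_avg_def by measurable

text \<open>Garsia's proof: \<open>m n\<close> is the maximum of the first \<open>n\<close> ergodic sums (including the empty one),
  and \<open>g \<ge> m - m \<circ> T\<close> wherever \<open>m\<close> is positive.\<close>

lemma maximal_ergodic:
  fixes g :: "'a \<Rightarrow> real"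
  assumes g[measurable]: "g \<in> borel_measurable M" and B: "\<And>x. \<bar>g x\<bar> \<le> B"
  shows "0 \<le> (\<integral>x. indicator {x \<in> space M. \<exists>n. (\<Sum>k<n. g ((T ^^ k) x)) > 0} x * g x \<partial>M)"
proof -
  have B0: "0 \<le> B" using B abs_ge_zero order_trans by blast
  define S where "S n x = (\<Sum>k<n. g ((T ^^ k) x))" for n x
  \<comment> \<open>A recursion in place of a maximum over a finite set: unfolding it once already
    yields Garsia's inequality. \<open>S_le\<close> and \<open>m_ex\<close> identify
    \<open>m n\<close> with the maximum of the sums \<open>S k\<close> for
    \<open>k \<le> n\<close>.\<close>
  define m where "m = rec_nat (\<lambda>x. 0) (\<lambda>n r x. max 0 (g x + r (T x)))"
  have m0: "m 0 x = 0" and mS: "m (Suc n) x = max 0 (g x + m n (T x))" for n x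
    by (simp_all add: m_def)
  have SS: "S (Suc n) x = g x + S n (T x)" for n x
    unfolding S_def by (subst sum.lessThan_Suc_shift) (simp add: funpow_swap1)
  have m_meas[measurable]: "m n \<in> borel_measurable M" for n
  proof (induction n)
    case 0 then show ?case by (simp add: m0[abs_def])
  next
    case (Suc n)
    then have [measurable]: "m n \<in> borel_measurable M" .
    have "(\<lambda>x. max 0 (g x + m n (T x))) \<in> borel_measurable M" by measurable
    then show ?case by (simp add: mS[abs_def])
  qed
  have m_ge0: "0 \<le> m n x" for n x by (cases n) (auto simp: m0 mS)
  have m_mono: "m n x \<le> m (Suc n) x" for n x
  proof (induction n arbitrary: x)
    case 0 then show ?case by (simp add: m0 mS)
  next
    case (Suc n)
    from Suc[of "T x"] show ?case unfolding mS[of "Suc n"] mS[of n] by auto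
  qed
  have m_le: "\<bar>m n x\<bar> \<le> real n * B" for n x
  proof (induction n arbitrary: x)
    case 0 then show ?case by (simp add: m0)
  next
    case (Suc n)
    have "m n (T x) \<le> real n * B" using Suc[of "T x"] by auto
    moreover have "g x \<le> B" "0 \<le> B" using B[of x] by auto
    moreover have "0 \<le> real n * B" using \<open>0 \<le> B\<close> by simp
    ultimately show ?case unfolding mS by (auto simp: algebra_simps)
  qed
  have S_le: "k \<le> n \<Longrightarrow> S k x \<le> m n x" for k n x
  proof (induction n arbitrary: k x)
    case 0 then show ?case by (simp add: S_def m0)
  next
    case (Suc n)
    show ?case
    proof (cases k)
      case 0 then show ?thesis using m_ge0 by (simp add: S_def)
    next
      case (Suc k')
      then show ?thesis using Suc.IH[of k' "T x"] Suc.prems by (auto simp: SS mS)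
    qed
  qed
  have m_ex: "\<exists>k\<le>n. m n x = S k x" for n x
  proof (induction n arbitrary: x)
    case 0 then show ?case by (simp add: S_def m0)
  next
    case (Suc n)
    then obtain k where k: "k \<le> n" "m n (T x) = S k (T x)" by blast
    show ?case
    proof (cases "g x + m n (T x) \<ge> 0")
      case True
      then show ?thesis using k by (intro exI[of _ "Suc k"]) (auto simp: mS SS)
    next
      case False
      then show ?thesis by (intro exI[of _ 0]) (auto simp: mS S_def)
    qed
  qed
  define E where "E n = {x \<in> space M. m n x > 0}" for n
  have [measurable]: "E n \<in> sets M" for n unfolding E_def by measurable
  have int_m: "integrable M (m n)" for n
    by (rule integrable_const_bound[of _ "real n * B"]) (auto simp: m_le)
  have int_mT: "integrable M (\<lambda>x. m n (T x))" for n
    by (rule integrable_const_bound[of _ "real n * B"]) (auto simp: m_le)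
  have int_g: "integrable M (\<lambda>x. indicator (E n) x * g x)" for n
    by (rule integrable_const_bound[of _ B]) (use B B0 in \<open>auto simp: indicator_def\<close>)
  have pos: "0 \<le> (\<integral>x. indicator (E n) x * g x \<partial>M)" for n
  proof (cases n)
    case 0 then show ?thesis by (simp add: E_def m0)
  next
    case (Suc n')
    have "0 = (\<integral>x. m n x - m n (T x) \<partial>M)"
      by (subst Bochner_Integration.integral_diff[OF int_m int_mT]) (simp add: integral_comp)
    also have "\<dots> \<le> (\<integral>x. indicator (E n) x * g x \<partial>M)"
    proof (rule integral_mono)
      fix x assume x: "x \<in> space M"
      show "m n x - m n (T x) \<le> indicator (E n) x * g x"
      proof (cases "m n x > 0")
        case True
        then have "m n x = g x + m n' (T x)" by (auto simp: Suc mS max_def split: if_splits)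
        then show ?thesis using x True m_mono[of n' "T x"] by (simp add: E_def Suc)
      next
        case False
        then show ?thesis using x m_ge0[of n x] m_ge0[of n "T x"] by (simp add: E_def)
      qed
    qed (use int_m int_mT int_g in auto)
    finally show ?thesis .
  qed
  have Elim: "{x \<in> space M. \<exists>n. S n x > 0} = (\<Union>n. E n)"
  proof (intro set_eqI iffI)
    fix x assume "x \<in> {x \<in> space M. \<exists>n. S n x > 0}"
    then obtain n where "x \<in> space M" "S n x > 0" by blast
    then show "x \<in> (\<Union>n. E n)" using S_le[of n n x] by (auto simp: E_def intro!: exI[of _ n])
  next
    fix x assume "x \<in> (\<Union>n. E n)"
    then obtain n where n: "x \<in> space M" "m n x > 0" by (auto simp: E_def)
    then show "x \<in> {x \<in> space M. \<exists>n. S n x > 0}" using m_ex[of n x] by force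
  qed
  have "(\<lambda>n. \<integral>x. indicator (E n) x * g x \<partial>M) \<longlonglongrightarrow> (\<integral>x. indicator (\<Union>n. E n) x * g x \<partial>M)"
  proof (rule integral_dominated_convergence[of _ _ _ "\<lambda>_. B"])
    show "AE x in M. (\<lambda>i. indicator (E i) x * g x) \<longlonglongrightarrow> indicator (\<Union>n. E n) x * g x"
    proof (intro AE_I2 tendsto_mult tendsto_const)
      fix x
      have "incseq E" unfolding E_def by (intro incseq_SucI subsetI) (use m_mono order_less_le_trans in \<open>fast\<close>)
      then show "(\<lambda>i. indicator (E i) x :: real) \<longlonglongrightarrow> indicator (\<Union>n. E n) x"
        by (rule LIMSEQ_indicator_incseq)
    qed
    show "AE x in M. norm (indicator (E i) x * g x) \<le> B" for i
      using B B0 by (auto simp: indicator_def)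
  qed auto
  then have "0 \<le> (\<integral>x. indicator (\<Union>n. E n) x * g x \<partial>M)"
    by (rule LIMSEQ_le_const) (use pos in auto)
  then show ?thesis using Elim by (simp add: S_def)
qed

section \<open>Invariance of the limits of ergodic averages, and Birkhoff's theorem\<close>

lemma sum_iterate_shift:
  "(\<Sum>k<Suc n. f ((T ^^ k) (T x))) = (\<Sum>k<Suc n. f ((T ^^ k) x)) + (f ((T ^^ Suc n) x) - f x :: real)"
proof -
  have "f x + (\<Sum>k<Suc n. f ((T ^^ k) (T x))) = (\<Sum>k<Suc (Suc n). f ((T ^^ k) x))"
    by (subst (2) sum.lessThan_Suc_shift) (simp add: funpow_swap1)
  then show ?thesis by simp
qed

lemma birkhoff_avg_shift:
  assumes B: "\<And>x. \<bar>f x\<bar> \<le> B"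
  shows "(\<lambda>n. birkhoff_avg T f n (T x) - birkhoff_avg T f n x) \<longlonglongrightarrow> 0"
proof -
  have eq: "birkhoff_avg T f n (T x) - birkhoff_avg T f n x = (f ((T ^^ Suc n) x) - f x) / real (Suc n)" for n
    unfolding birkhoff_avg_def sum_iterate_shift by (simp add: diff_divide_distrib add_divide_distrib)
  have "(\<lambda>n. 2 * B * (1 / real (Suc n))) \<longlonglongrightarrow> 2 * B * 0"
    by (intro tendsto_mult tendsto_const LIMSEQ_Suc lim_1_over_n)
  then have lim: "(\<lambda>n. 2 * B * (1 / real (Suc n))) \<longlonglongrightarrow> 0" by simp
  show ?thesis
  proof (rule Lim_null_comparison[OF _ lim])
    have "norm ((f ((T ^^ Suc n) x) - f x) / real (Suc n)) \<le> 2 * B * (1 / real (Suc n))" for n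
    proof -
      have "\<bar>f ((T ^^ Suc n) x) - f x\<bar> \<le> 2 * B" using B[of "(T ^^ Suc n) x"] B[of x] by linarith
      then show ?thesis by (simp add: divide_right_mono del: of_nat_Suc funpow.simps)
    qed
    then show "\<forall>\<^sub>F n in sequentially. norm (birkhoff_avg T f n (T x) - birkhoff_avg T f n x) \<le> 2 * B * (1 / real (Suc n))"
      unfolding eq by simp
  qed
qed

lemma birkhoff_convergent_shift:
  assumes "\<And>x. \<bar>f x\<bar> \<le> B"
  shows "(\<lambda>n. birkhoff_avg T f n (T x)) \<longlonglongrightarrow> l \<longleftrightarrow> (\<lambda>n. birkhoff_avg T f n x) \<longlonglongrightarrow> l"
proof
  assume "(\<lambda>n. birkhoff_avg T f n (T x)) \<longlonglongrightarrow> l"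
  from tendsto_diff[OF this birkhoff_avg_shift[of f B x, OF assms]]
  show "(\<lambda>n. birkhoff_avg T f n x) \<longlonglongrightarrow> l" by simp
next
  assume "(\<lambda>n. birkhoff_avg T f n x) \<longlonglongrightarrow> l"
  from tendsto_add[OF this birkhoff_avg_shift[of f B x, OF assms]]
  show "(\<lambda>n. birkhoff_avg T f n (T x)) \<longlonglongrightarrow> l" by simp
qed

lemma birkhoff_limsup_shift:
  assumes "\<And>x. \<bar>f x\<bar> \<le> B"
  shows "limsup (\<lambda>n. ereal (birkhoff_avg T f n (T x))) = limsup (\<lambda>n. ereal (birkhoff_avg T f n x))"
    and "liminf (\<lambda>n. ereal (birkhoff_avg T f n (T x))) = liminf (\<lambda>n. ereal (birkhoff_avg T f n x))"
proof -
  have lim: "(\<lambda>n. ereal (birkhoff_avg T f n (T x) - birkhoff_avg T f n x)) \<longlonglongrightarrow> ereal 0"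
    using birkhoff_avg_shift[OF assms] by (simp add: tendsto_ereal)
  show "limsup (\<lambda>n. ereal (birkhoff_avg T f n (T x))) = limsup (\<lambda>n. ereal (birkhoff_avg T f n x))"
    using ereal_limsup_lim_add[OF lim, of "\<lambda>n. ereal (birkhoff_avg T f n x)"] by (simp flip: zero_ereal_def)
  show "liminf (\<lambda>n. ereal (birkhoff_avg T f n (T x))) = liminf (\<lambda>n. ereal (birkhoff_avg T f n x))"
    using ereal_liminf_lim_add[OF lim, of "\<lambda>n. ereal (birkhoff_avg T f n x)"] by (simp flip: zero_ereal_def)
qed

text \<open>Cutting \<open>f\<close> down to an invariant set commutes with taking ergodic sums, so
  the set of \<open>maximal_ergodic\<close> for the cut-off function is exactly
  \<open>A\<close>.\<close>

lemma invariant_maximal: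
  fixes f :: "'a \<Rightarrow> real"
  assumes f[measurable]: "f \<in> borel_measurable M" and B: "\<And>x. \<bar>f x\<bar> \<le> B"
    and A[measurable]: "A \<in> sets M" and inv: "\<And>x. x \<in> space M \<Longrightarrow> T x \<in> A \<longleftrightarrow> x \<in> A"
    and pos: "\<And>x. x \<in> A \<Longrightarrow> \<exists>n. (\<Sum>k<n. f ((T ^^ k) x)) > 0"
  shows "0 \<le> (\<integral>x. indicator A x * f x \<partial>M)"
proof -
  define g where "g x = indicator A x * f x" for x
  have invk: "(T ^^ k) x \<in> A \<longleftrightarrow> x \<in> A" if "x \<in> space M" for k x
    using that
  proof (induction k arbitrary: x)
    case (Suc k)
    have "T x \<in> space M" using Suc.prems measurable_space[OF T_meas] by blast
    then show ?case using Suc.IH[of "T x"] inv[OF Suc.prems] by (simp add: funpow_swap1)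
  qed simp
  have sum: "(\<Sum>k<n. g ((T ^^ k) x)) = indicator A x * (\<Sum>k<n. f ((T ^^ k) x))" if "x \<in> space M" for n x
    unfolding g_def using invk[OF that] by (simp add: sum_distrib_left indicator_def)
  have E: "{x \<in> space M. \<exists>n. (\<Sum>k<n. g ((T ^^ k) x)) > 0} = A"
    using sets.sets_into_space[OF A] pos by (auto simp: sum split: split_indicator_asm)
  have "\<bar>g x\<bar> \<le> B" for x using B[of x] by (auto simp: g_def indicator_def)
  moreover have "g \<in> borel_measurable M" unfolding g_def by measurable
  ultimately have "0 \<le> (\<integral>x. indicator A x * g x \<partial>M)"
    using maximal_ergodic[of g B] unfolding E by blast
  also have "(\<lambda>x. indicator A x * g x) = (\<lambda>x. indicator A x * f x)"
    by (auto simp: g_def indicator_def)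
  finally show ?thesis .
qed

text \<open>If the averages oscillate, they do so across some rational gap \<open>a < b\<close>. The
  set \<open>A\<close> of points that oscillate across it is invariant, and the maximal inequality
  on it applies to \<open>f - b\<close> as well as to \<open>a - f\<close>. Adding the two gives
  \<open>0 \<le> (a - b) * measure M A\<close>, so \<open>A\<close> is null.\<close>

theorem birkhoff:
  fixes f :: "'a \<Rightarrow> real"
  assumes f[measurable]: "f \<in> borel_measurable M" and B: "\<And>x. \<bar>f x\<bar> \<le> B"
  shows "AE x in M. convergent (\<lambda>n. birkhoff_avg T f n x)"
proof -
  define u where "u x = limsup (\<lambda>n. ereal (birkhoff_avg T f n x))" for x
  define l where "l x = liminf (\<lambda>n. ereal (birkhoff_avg T f n x))" for x
  have [measurable]: "u \<in> borel_measurable M" "l \<in> borel_measurable M"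
    unfolding u_def l_def by measurable
  have null: "AE x in M. \<not> (l x < ereal a \<and> ereal b < u x)" if ab: "a < b" for a b :: real
  proof -
    define A where "A = {x \<in> space M. l x < ereal a \<and> ereal b < u x}"
    have A[measurable]: "A \<in> sets M" unfolding A_def by measurable
    have inv: "T x \<in> A \<longleftrightarrow> x \<in> A" if "x \<in> space M" for x
      using that measurable_space[OF T_meas that]
      by (simp add: A_def u_def l_def birkhoff_limsup_shift[OF B])
    have 1: "0 \<le> (\<integral>x. indicator A x * (f x - b) \<partial>M)"
    proof (rule invariant_maximal[where B = "B + \<bar>b\<bar>", OF _ _ A inv])
      show "\<bar>f x - b\<bar> \<le> B + \<bar>b\<bar>" for x using B[of x] by linarith
      fix x assume "x \<in> A"
      then have "ereal b < u x" by (simp add: A_def)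
      then have "\<exists>n. ereal b < ereal (birkhoff_avg T f n x)"
        unfolding u_def using Limsup_bounded[OF always_eventually, of "\<lambda>n. ereal (birkhoff_avg T f n x)" "ereal b" sequentially]
        by (meson leD leI)
      then obtain n where "b < birkhoff_avg T f n x" by auto
      then have "0 < (\<Sum>k<Suc n. f ((T ^^ k) x) - b)"
        unfolding birkhoff_avg_def sum_subtractf by (simp add: field_simps)
      then show "\<exists>n. 0 < (\<Sum>k<n. f ((T ^^ k) x) - b)" by blast
    qed auto
    have 2: "0 \<le> (\<integral>x. indicator A x * (a - f x) \<partial>M)"
    proof (rule invariant_maximal[where B = "B + \<bar>a\<bar>", OF _ _ A inv])
      show "\<bar>a - f x\<bar> \<le> B + \<bar>a\<bar>" for x using B[of x] by linarith
      fix x assume "x \<in> A"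
      then have "l x < ereal a" by (simp add: A_def)
      then have "\<exists>n. ereal (birkhoff_avg T f n x) < ereal a"
        unfolding l_def using Liminf_bounded[OF always_eventually, of "ereal a" "\<lambda>n. ereal (birkhoff_avg T f n x)" sequentially]
        by (meson leD leI)
      then obtain n where "birkhoff_avg T f n x < a" by auto
      then have "0 < (\<Sum>k<Suc n. a - f ((T ^^ k) x))"
        unfolding birkhoff_avg_def sum_subtractf by (simp add: field_simps)
      then show "\<exists>n. 0 < (\<Sum>k<n. a - f ((T ^^ k) x))" by blast
    qed auto
    have i1: "integrable M (\<lambda>x. indicator A x * (f x - b))"
    proof (rule integrable_const_bound[of _ "B + \<bar>b\<bar>"])
      have "\<bar>f x - b\<bar> \<le> B + \<bar>b\<bar>" "0 \<le> B + \<bar>b\<bar>" for x using B[of x] by linarith+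
      then show "AE x in M. norm (indicator A x * (f x - b)) \<le> B + \<bar>b\<bar>" by (auto simp: indicator_def)
    qed auto
    have i2: "integrable M (\<lambda>x. indicator A x * (a - f x))"
    proof (rule integrable_const_bound[of _ "B + \<bar>a\<bar>"])
      have "\<bar>a - f x\<bar> \<le> B + \<bar>a\<bar>" "0 \<le> B + \<bar>a\<bar>" for x using B[of x] by linarith+
      then show "AE x in M. norm (indicator A x * (a - f x)) \<le> B + \<bar>a\<bar>" by (auto simp: indicator_def)
    qed auto
    have "0 \<le> (\<integral>x. indicator A x * (f x - b) + indicator A x * (a - f x) \<partial>M)"
      using 1 2 by (simp add: Bochner_Integration.integral_add[OF i1 i2])
    also have "(\<lambda>x. indicator A x * (f x - b) + indicator A x * (a - f x)) = (\<lambda>x. (a - b) * indicator A x)"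
      by (auto simp: indicator_def)
    finally have "0 \<le> (a - b) * measure M A" by simp
    then have "measure M A = 0" using ab measure_nonneg[of M A] by (simp add: zero_le_mult_iff)
    then have "A \<in> null_sets M" using A by (simp add: emeasure_eq_measure null_setsI)
    then have "AE x in M. x \<notin> A" by (rule AE_not_in)
    then show ?thesis by (auto simp: A_def)
  qed
  have "AE x in M. \<forall>q \<in> {q :: rat \<times> rat. fst q < snd q}. \<not> (l x < ereal (of_rat (fst q)) \<and> ereal (of_rat (snd q)) < u x)"
    by (subst AE_ball_countable) (use null in \<open>auto simp: of_rat_less\<close>)
  then show ?thesis
  proof (eventually_elim)
    fix x assume *: "\<forall>q \<in> {q :: rat \<times> rat. fst q < snd q}. \<not> (l x < ereal (of_rat (fst q)) \<and> ereal (of_rat (snd q)) < u x)"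
    \<comment> \<open>The uniform bound keeps upper and lower limit finite; a gap between them then
      contains two rationals, and a common value is a real number.\<close>
    have avgB: "\<bar>birkhoff_avg T f n x\<bar> \<le> B" for n
    proof -
      have "\<bar>\<Sum>k<Suc n. f ((T ^^ k) x)\<bar> \<le> real (Suc n) * B"
        using sum_norm_bound[of "{..<Suc n}" "\<lambda>k. f ((T ^^ k) x)" B] B by simp
      then show ?thesis unfolding birkhoff_avg_def by (simp add: field_simps)
    qed
    have lu: "l x \<le> u x" unfolding l_def u_def by (rule Liminf_le_Limsup) simp
    have ub: "u x \<le> ereal B" unfolding u_def
      by (rule Limsup_bounded) (use avgB in \<open>auto simp: abs_le_iff\<close>)
    have lb: "ereal (-B) \<le> l x" unfolding l_def
      by (rule Liminf_bounded) (use avgB in \<open>auto simp: abs_le_iff minus_le_iff\<close>)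
    have "u x \<le> l x"
    proof (rule ccontr)
      assume "\<not> u x \<le> l x"
      then have lt: "l x < u x" by simp
      from ub lb lu obtain l' u' where lu': "l x = ereal l'" "u x = ereal u'"
        by (cases "l x"; cases "u x") auto
      then have "l' < u'" using lt by simp
      obtain p where p: "l' < of_rat p" "of_rat p < u'" using of_rat_dense[OF \<open>l' < u'\<close>] by auto
      obtain q where q: "of_rat p < (of_rat q :: real)" "of_rat q < u'" using of_rat_dense[OF p(2)] by auto
      have "p < q" using q(1) by (simp add: of_rat_less)
      then show False using * p q lu' by force
    qed
    then have eq: "l x = u x" using lu by simp
    from ub lb eq obtain c where c: "u x = ereal c" by (cases "u x") auto
    have "(\<lambda>n. ereal (birkhoff_avg T f n x)) \<longlonglongrightarrow> ereal c"
      using Liminf_eq_Limsup[of sequentially "\<lambda>n. ereal (birkhoff_avg T f n x)" "ereal c"] eq c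
      by (simp add: l_def u_def)
    then show "convergent (\<lambda>n. birkhoff_avg T f n x)"
      by (auto simp: convergent_def)
  qed
qed


text \<open>The default 0 is that of \<open>rotation_number\<close>, so the two agree at every point
  and not only almost everywhere.\<close>

definition birkhoff_limit :: "('a \<Rightarrow> real) \<Rightarrow> 'a \<Rightarrow> real" where
  "birkhoff_limit f x =
     (if convergent (\<lambda>n. birkhoff_avg T f n x) then lim (\<lambda>n. birkhoff_avg T f n x) else 0)"

text \<open>Convergence is rewritten as the Cauchy property, which is a countable condition on the
  averages.\<close>

lemma birkhoff_limit_meas[measurable]:
  assumes [measurable]: "f \<in> borel_measurable M"
  shows "birkhoff_limit f \<in> borel_measurable M"
  unfolding birkhoff_limit_def[abs_def] Cauchy_convergent_iff[symmetric]
  by (intro measurable_If borel_measurable_lim_metric) measurable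

text \<open>The averages at \<open>x\<close> and at \<open>T x\<close> converge together, so this
  holds at every point, including those with the default value. The sets in the definition of
  \<open>ergodic\<close> are exactly invariant, and almost everywhere invariance would not do
  there.\<close>

lemma birkhoff_limit_shift:
  assumes "\<And>x. \<bar>f x\<bar> \<le> B"
  shows "birkhoff_limit f (T x) = birkhoff_limit f x"
  unfolding birkhoff_limit_def convergent_def lim_def birkhoff_convergent_shift[of f B, OF assms] ..

lemma birkhoff_limit_shift_pow:
  assumes "\<And>x. \<bar>f x\<bar> \<le> B"
  shows "birkhoff_limit f ((T ^^ n) x) = birkhoff_limit f x"
  by (induction n) (simp_all add: birkhoff_limit_shift[of f B, OF assms])

lemma birkhoff_avg_range:
  assumes "\<And>x. 0 \<le> f x" "\<And>x. f x \<le> 1"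
  shows "birkhoff_avg T f n x \<in> {0..1}"
proof -
  have "(\<Sum>k<Suc n. f ((T ^^ k) x)) \<le> real (card {..<Suc n}) * 1"
    by (rule sum_bounded_above) (use assms in auto)
  moreover have "0 \<le> (\<Sum>k<Suc n. f ((T ^^ k) x))" by (intro sum_nonneg assms)
  ultimately show ?thesis by (simp add: birkhoff_avg_def field_simps)
qed

lemma birkhoff_limit_range:
  assumes "\<And>x. 0 \<le> f x" "\<And>x. f x \<le> 1"
  shows "birkhoff_limit f x \<in> {0..1}"
proof (cases "convergent (\<lambda>n. birkhoff_avg T f n x)")
  case True
  then have "(\<lambda>n. birkhoff_avg T f n x) \<longlonglongrightarrow> birkhoff_limit f x"
    by (simp add: birkhoff_limit_def convergent_LIMSEQ_iff)
  then show ?thesis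
    by (rule closed_sequentially[OF closed_atLeastAtMost, rotated]) (use birkhoff_avg_range assms in blast)
qed (simp add: birkhoff_limit_def)

text \<open>Reversing an orbit segment of length \<open>n\<close> is measure preserving and turns the ergodic average \<open>u\<close>
  into \<open>1 - u\<close>; comparing in \<open>L\<^sup>1\<close> avoids the backward ergodic theorem.\<close>

theorem birkhoff_limit_reversal:
  assumes I: "measure_preserving_map M I"
    and f[measurable]: "f \<in> borel_measurable M" and f0: "\<And>x. 0 \<le> f x" and f1: "\<And>x. f x \<le> 1"
    and rev: "AE x in M. T (I (T x)) = I x"
    and frev: "AE x in M. f (I (T x)) = 1 - f x"
  shows "AE x in M. birkhoff_limit f (I x) = 1 - birkhoff_limit f x"
proof -
  interpret I: measure_preserving_map M I by fact
  note [measurable] = I.T_meas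
  let ?R = "birkhoff_limit f" and ?u = "birkhoff_avg T f"
  have fB: "\<bar>f x\<bar> \<le> 1" for x using f0[of x] f1[of x] by auto
  have R01: "0 \<le> ?R x" "?R x \<le> 1" for x using birkhoff_limit_range[of f, OF f0 f1] by auto
  have u01: "0 \<le> ?u n x" "?u n x \<le> 1" for n x using birkhoff_avg_range[of f, OF f0 f1] by auto
  define e where "e n = (\<integral>x. \<bar>?R x - ?u n x\<bar> \<partial>M)" for n
  have bd: "\<bar>?R x - ?u n y\<bar> \<le> 1" for x y n using R01[of x] u01[of n y] by auto
  have "e \<longlonglongrightarrow> (\<integral>x. 0 \<partial>M)" unfolding e_def
  proof (rule integral_dominated_convergence[of _ _ _ "\<lambda>_. 1"])
    show "AE x in M. (\<lambda>i. \<bar>?R x - ?u i x\<bar>) \<longlonglongrightarrow> 0"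
      using birkhoff[OF f fB]
    proof eventually_elim
      fix x assume "convergent (\<lambda>n. ?u n x)"
      then have "(\<lambda>n. ?u n x) \<longlonglongrightarrow> ?R x" by (simp add: birkhoff_limit_def convergent_LIMSEQ_iff)
      from tendsto_rabs_zero[OF tendsto_diff[OF tendsto_const[of "?R x"] this, simplified]]
      show "(\<lambda>i. \<bar>?R x - ?u i x\<bar>) \<longlonglongrightarrow> 0" .
    qed
    show "AE x in M. norm \<bar>?R x - ?u i x\<bar> \<le> 1" for i using bd by auto
  qed auto
  then have e0: "e \<longlonglongrightarrow> 0" by simp
  have orbit: "AE x in M. ?u n (I ((T ^^ Suc n) x)) = 1 - ?u n x \<and> ?R (I ((T ^^ Suc n) x)) = ?R (I x)" for n
    using AE_iterates[OF rev] AE_iterates[OF frev]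
  proof eventually_elim
    fix x assume 1: "\<forall>k. T (I (T ((T ^^ k) x))) = I ((T ^^ k) x)"
      and 2: "\<forall>k. f (I (T ((T ^^ k) x))) = 1 - f ((T ^^ k) x)"
    \<comment> \<open>Each application of \<open>T\<close> to a reversed point undoes one step of
      the orbit.\<close>
    have rewind: "(T ^^ j) (I ((T ^^ m) x)) = I ((T ^^ (m - j)) x)" if "j \<le> m" for j m
      using that
    proof (induction j)
      case (Suc j)
      then have "m - j = Suc (m - Suc j)" by simp
      then show ?case using Suc 1[rule_format, of "m - Suc j"] by simp
    qed simp
    \<comment> \<open>The \<open>k\<close>-th step of the reversed segment retraces the step that
      the orbit made at time \<open>n - k\<close>, written \<open>Suc n - Suc k\<close>.\<close>
    have "(\<Sum>k<Suc n. f ((T ^^ k) (I ((T ^^ Suc n) x)))) = (\<Sum>k<Suc n. 1 - f ((T ^^ (Suc n - Suc k)) x))"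
    proof (rule sum.cong[OF refl])
      fix k assume "k \<in> {..<Suc n}"
      then have "k \<le> Suc n" and *: "Suc n - k = Suc (Suc n - Suc k)" by auto
      show "f ((T ^^ k) (I ((T ^^ Suc n) x))) = 1 - f ((T ^^ (Suc n - Suc k)) x)"
        unfolding rewind[OF \<open>k \<le> Suc n\<close>] * using 2[rule_format, of "Suc n - Suc k"] by simp
    qed
    also have "\<dots> = (\<Sum>k<Suc n. 1 - f ((T ^^ k) x))"
      by (rule sum.nat_diff_reindex)
    also have "\<dots> = real (Suc n) - (\<Sum>k<Suc n. f ((T ^^ k) x))"
      by (simp add: sum_subtractf)
    finally have "?u n (I ((T ^^ Suc n) x)) = 1 - ?u n x"
      unfolding birkhoff_avg_def by (simp add: diff_divide_distrib)
    moreover have "?R (I ((T ^^ Suc n) x)) = ?R (I x)"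
      using birkhoff_limit_shift_pow[of f 1 "Suc n" "I ((T ^^ Suc n) x)", OF fB]
      unfolding rewind[OF order_refl] by simp
    ultimately show "?u n (I ((T ^^ Suc n) x)) = 1 - ?u n x \<and> ?R (I ((T ^^ Suc n) x)) = ?R (I x)" ..
  qed
  define c where "c = (\<integral>x. \<bar>?R (I x) - (1 - ?R x)\<bar> \<partial>M)"
  have int: "integrable M (\<lambda>x. \<bar>?R (I x) - (1 - ?R x)\<bar>)"
  proof (rule integrable_const_bound[of _ 1])
    have "\<bar>?R (I x) - (1 - ?R x)\<bar> \<le> 1" for x using R01[of x] R01[of "I x"] by linarith
    then show "AE x in M. norm \<bar>?R (I x) - (1 - ?R x)\<bar> \<le> 1" by simp
  qed measurable
  \<comment> \<open>At \<open>I ((T ^^ Suc n) x)\<close> the average is \<open>1 - ?u n x\<close>,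
    while the limit is \<open>?R (I x)\<close> by invariance. The triangle inequality bounds the
    defect by two deviations of an average from its limit, and measure preservation gives both of
    them the integral \<open>e n\<close>.\<close>
  have le: "c \<le> 2 * e n" for n
  proof -
    interpret N: measure_preserving_map M "T ^^ Suc n" by (rule pow_preserving)
    have i1: "integrable M (\<lambda>x. \<bar>?R (I ((T ^^ Suc n) x)) - ?u n (I ((T ^^ Suc n) x))\<bar>)"
      by (rule integrable_const_bound[of _ 1]) (use bd in auto)
    have i2: "integrable M (\<lambda>x. \<bar>?R x - ?u n x\<bar>)"
      by (rule integrable_const_bound[of _ 1]) (use bd in auto)
    have "c \<le> (\<integral>x. \<bar>?R (I ((T ^^ Suc n) x)) - ?u n (I ((T ^^ Suc n) x))\<bar> + \<bar>?R x - ?u n x\<bar> \<partial>M)"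
      unfolding c_def
    proof (rule integral_mono_AE[OF int Bochner_Integration.integrable_add[OF i1 i2]])
      show "AE x in M. \<bar>?R (I x) - (1 - ?R x)\<bar> \<le> \<bar>?R (I ((T ^^ Suc n) x)) - ?u n (I ((T ^^ Suc n) x))\<bar> + \<bar>?R x - ?u n x\<bar>"
        using orbit[of n] by eventually_elim linarith
    qed
    also have "\<dots> = (\<integral>x. \<bar>?R (I ((T ^^ Suc n) x)) - ?u n (I ((T ^^ Suc n) x))\<bar> \<partial>M) + e n"
      unfolding e_def by (rule Bochner_Integration.integral_add[OF i1 i2])
    also have "(\<integral>x. \<bar>?R (I ((T ^^ Suc n) x)) - ?u n (I ((T ^^ Suc n) x))\<bar> \<partial>M) = (\<integral>x. \<bar>?R (I x) - ?u n (I x)\<bar> \<partial>M)"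
      by (rule N.integral_comp) measurable
    also have "\<dots> = e n" unfolding e_def by (rule I.integral_comp) measurable
    finally show ?thesis by simp
  qed
  have "(\<lambda>n. 2 * e n) \<longlonglongrightarrow> 2 * 0" by (intro tendsto_intros e0)
  then have "c \<le> 0" using le by (intro LIMSEQ_le_const[of "\<lambda>n. 2 * e n"]) auto
  moreover have "0 \<le> c" unfolding c_def by simp
  ultimately have "c = 0" by simp
  then have "AE x in M. \<bar>?R (I x) - (1 - ?R x)\<bar> = 0"
    using integral_nonneg_eq_0_iff_AE[OF int] by (simp add: c_def)
  then show ?thesis by eventually_elim simp
qed

end

section \<open>The area formula in one variable and integrals over the circle\<close>

text \<open>Sard's lemma in dimension one. The detour through \<open>real ^ 1\<close> is the form in
  which \<open>baby_Sard\<close> is stated: a derivative of rank below the dimension.\<close>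

lemma negligible_critical_values:
  fixes h :: "real \<Rightarrow> real"
  assumes "\<And>x. x \<in> C \<Longrightarrow> (h has_real_derivative 0) (at x)"
  shows "negligible (h ` C)"
proof -
  define F where "F x = ((\<chi> i. h (x $ 1)) :: real ^ 1)" for x :: "real ^ 1"
  define C' where "C' = {x :: real ^ 1. x $ 1 \<in> C}"
  have "negligible (F ` C')"
  proof (rule baby_Sard[where f' = "\<lambda>x y. 0"])
    fix x assume x: "x \<in> C'"
    then have "(h has_derivative (\<lambda>_. 0)) (at (x $ 1))"
      using assms[of "x $ 1"] by (simp add: C'_def has_field_derivative_def lambda_zero)
    then have "((\<lambda>x. h (x $ 1)) has_derivative (\<lambda>_. 0)) (at x)"
      using has_derivative_compose[of "\<lambda>x. x $ 1" "\<lambda>x. x $ 1" x UNIV h "\<lambda>_. 0"]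
      by (simp add: bounded_linear_imp_has_derivative bounded_linear_vec_nth)
    then have "(F has_derivative (\<lambda>y. \<chi> i. 0)) (at x)"
      unfolding F_def by (subst has_derivative_componentwise_within) (auto simp: Basis_vec_def inner_axis)
    moreover have "(\<lambda>y::real^1. (\<chi> i. 0) :: real ^ 1) = (\<lambda>_. 0)" by (auto simp: vec_eq_iff)
    ultimately show "(F has_derivative (\<lambda>y. 0)) (at x within C')"
      by (metis has_derivative_at_withinI)
    show "rank (matrix (\<lambda>y::real^1. 0 :: real ^ 1)) < CARD(1)"
      by (simp add: matrix_def zero_vec_def[symmetric])
  qed simp
  then have "negligible ((\<lambda>x. x $ 1) ` F ` C')"
    by (intro negligible_differentiable_image_negligible[where S = "F ` C'" and f = "\<lambda>x. x $ 1"]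
        linear_imp_differentiable_on bounded_linear.linear bounded_linear_vec_nth) auto
  moreover have "(\<lambda>x. x $ 1) ` F ` C' = h ` C"
    by (force simp: F_def C'_def image_image image_iff intro: exI[of _ "\<chi> i. _"])
  ultimately show ?thesis by simp
qed

text \<open>A continuous derivative without zeros has one sign on the interval, so \<open>h\<close>
  is monotone and its image is an interval. Reflecting the target variable reduces the decreasing
  case to the increasing one.\<close>

lemma nn_integral_substitution_abs:
  fixes f :: "real \<Rightarrow> ennreal" and h h' :: "real \<Rightarrow> real"
  assumes f[measurable]: "f \<in> borel_measurable borel" and "a < b"
    and der: "\<And>x. x \<in> {a..b} \<Longrightarrow> (h has_real_derivative h' x) (at x)"
    and cont: "continuous_on {a..b} h'" and nz: "\<And>x. x \<in> {a..b} \<Longrightarrow> h' x \<noteq> 0"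
  shows "(\<integral>\<^sup>+p. f p * indicator (h ` {a..b}) p \<partial>lborel) =
         (\<integral>\<^sup>+x. f (h x) * ennreal \<bar>h' x\<bar> * indicator {a..b} x \<partial>lborel)"
proof -
  have conth: "continuous_on {a..b} h" using der by (meson DERIV_continuous_on has_field_derivative_at_within)
  have "(\<forall>x\<in>{a..b}. h' x > 0) \<or> (\<forall>x\<in>{a..b}. h' x < 0)"
  proof (rule ccontr)
    assume "\<not> ?thesis"
    then obtain x y where xy: "x \<in> {a..b}" "y \<in> {a..b}" "h' x < 0" "h' y > 0"
      using nz by (metis linorder_neqE_linordered_idom)
    have "connected (h' ` {a..b})" by (intro connected_continuous_image cont) simp
    then have "0 \<in> h' ` {a..b}"
      using xy connectedD_interval[of "h' ` {a..b}" "h' x" "h' y" 0] by auto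
    then show False using nz by force
  qed
  then show ?thesis
  proof
    assume pos: "\<forall>x\<in>{a..b}. h' x > 0"
    have mono: "h x \<le> h y" if "a \<le> x" "x \<le> y" "y \<le> b" for x y
    proof (rule DERIV_nonneg_imp_nondecreasing[OF that(2)])
      fix z assume "x \<le> z" "z \<le> y"
      then have "z \<in> {a..b}" using that by auto
      then show "\<exists>D. (h has_real_derivative D) (at z) \<and> 0 \<le> D" using der pos less_imp_le by blast
    qed
    have "h ` {a..b} = {h a..h b}"
    proof
      show "h ` {a..b} \<subseteq> {h a..h b}" using mono \<open>a < b\<close> by auto
      show "{h a..h b} \<subseteq> h ` {a..b}"
        using IVT'[of h a _ b] conth \<open>a < b\<close> by force
    qed
    then show ?thesis
      using nn_integral_substitution_aux[OF f _ der cont _ \<open>a < b\<close>] pos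
      by (auto simp: less_imp_le intro!: nn_integral_cong split: split_indicator)
  next
    assume neg: "\<forall>x\<in>{a..b}. h' x < 0"
    have mono: "h y \<le> h x" if "a \<le> x" "x \<le> y" "y \<le> b" for x y
    proof (rule DERIV_nonpos_imp_nonincreasing[OF that(2)])
      fix z assume "x \<le> z" "z \<le> y"
      then have "z \<in> {a..b}" using that by auto
      then show "\<exists>D. (h has_real_derivative D) (at z) \<and> D \<le> 0" using der neg less_imp_le by blast
    qed
    have im: "h ` {a..b} = {h b..h a}"
    proof
      show "h ` {a..b} \<subseteq> {h b..h a}" using mono \<open>a < b\<close> by auto
      show "{h b..h a} \<subseteq> h ` {a..b}"
        using IVT2'[of h b _ a] conth \<open>a < b\<close> by force
    qed
    have "(\<integral>\<^sup>+p. f p * indicator {h b..h a} p \<partial>lborel) = (\<integral>\<^sup>+p. f (- p) * indicator {h b..h a} (- p) \<partial>lborel)"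
      by (subst nn_integral_real_affine[of _ "-1" 0]) auto
    also have "\<dots> = (\<integral>\<^sup>+p. f (- p) * indicator {- h a..- h b} p \<partial>lborel)"
      by (intro nn_integral_cong) (auto split: split_indicator)
    also have "\<dots> = (\<integral>\<^sup>+x. f (- (- h x)) * ennreal (- h' x) * indicator {a..b} x \<partial>lborel)"
      by (rule nn_integral_substitution_aux[of "\<lambda>p. f (- p)" a b "\<lambda>x. - h x" "\<lambda>x. - h' x"])
        (use neg \<open>a < b\<close> in \<open>auto intro!: continuous_intros cont derivative_intros der less_imp_le\<close>)
    also have "\<dots> = (\<integral>\<^sup>+x. f (h x) * ennreal \<bar>h' x\<bar> * indicator {a..b} x \<partial>lborel)"
      by (intro nn_integral_cong) (use neg in \<open>auto simp: abs_of_neg split: split_indicator\<close>)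
    finally show ?thesis by (simp add: im)
  qed
qed

text \<open>By the mean value theorem \<open>h\<close> is injective here, so every fibre has at most
  one point and the sum over it is the weight at the inverse image. The second claim is what permits
  summing over countably many intervals later.\<close>

lemma area_formula_interval:
  fixes k :: "real \<Rightarrow> ennreal" and h h' :: "real \<Rightarrow> real"
  assumes k[measurable]: "k \<in> borel_measurable borel" and "a < b"
    and der: "\<And>x. x \<in> {a..b} \<Longrightarrow> (h has_real_derivative h' x) (at x)"
    and cont: "continuous_on {a..b} h'" and nz: "\<And>x. x \<in> {a..b} \<Longrightarrow> h' x \<noteq> 0"
  shows "(\<integral>\<^sup>+s. k s * ennreal \<bar>h' s\<bar> * indicator {a..b} s \<partial>lborel) =
         (\<integral>\<^sup>+p. (\<integral>\<^sup>+s. k s * indicator {s \<in> {a..b}. h s = p} s \<partial>count_space UNIV) \<partial>lborel)"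
    and "(\<lambda>p. \<integral>\<^sup>+s. k s * indicator {s \<in> {a..b}. h s = p} s \<partial>count_space UNIV) \<in> borel_measurable borel"
proof -
  define g where "g = inv_into {a..b} h"
  define A where "A = h ` {a..b}"
  have conth: "continuous_on {a..b} h" using der by (meson DERIV_continuous_on has_field_derivative_at_within)
  have "x = y" if "x \<in> {a..b}" "y \<in> {a..b}" "h x = h y" for x y
  proof (rule ccontr)
    assume "x \<noteq> y"
    have *: False if "x < y" "x \<in> {a..b}" "y \<in> {a..b}" "h x = h y" for x y
    proof -
      have "\<exists>z. z > x \<and> z < y \<and> h y - h x = (y - x) * h' z"
        by (rule MVT2) (use that der in auto)
      then show False using that nz by auto
    qed
    show False using *[of x y] *[of y x] that \<open>x \<noteq> y\<close> by fastforce
  qed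
  then have inj: "inj_on h {a..b}" by (auto intro: inj_onI)
  have gh: "g (h s) = s" if "s \<in> {a..b}" for s using that inj by (simp add: g_def)
  have contg: "continuous_on A g"
    unfolding A_def by (rule continuous_on_inv[OF conth]) (auto simp: gh)
  have A: "A \<in> sets borel"
    unfolding A_def by (intro borel_compact compact_continuous_image conth) simp
  note [measurable] = A borel_measurable_continuous_on_indicator[OF A contg]
  \<comment> \<open>The inverse is continuous only on the compact image \<open>A\<close>; the
    cut-off inside the argument of \<open>k\<close> makes the composition Borel on the whole
    line.\<close>
  define f where "f p = k (indicator A p *\<^sub>R g p) * indicator A p" for p
  have f[measurable]: "f \<in> borel_measurable borel" unfolding f_def by measurable
  have eq: "(\<integral>\<^sup>+s. k s * indicator {s \<in> {a..b}. h s = p} s \<partial>count_space UNIV) = f p" for p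
  proof (cases "p \<in> A")
    case True
    then have "{s \<in> {a..b}. h s = p} = {g p}" using gh by (force simp: A_def)
    then show ?thesis using True
      by (simp add: f_def nn_integral_count_space_indicator[symmetric] nn_integral_count_space_finite)
  next
    case False
    then have "{s \<in> {a..b}. h s = p} = {}" by (auto simp: A_def)
    then show ?thesis using False by (simp add: f_def)
  qed
  show "(\<lambda>p. \<integral>\<^sup>+s. k s * indicator {s \<in> {a..b}. h s = p} s \<partial>count_space UNIV) \<in> borel_measurable borel"
    unfolding eq by measurable
  have "(\<integral>\<^sup>+s. k s * ennreal \<bar>h' s\<bar> * indicator {a..b} s \<partial>lborel) =
      (\<integral>\<^sup>+s. f (h s) * ennreal \<bar>h' s\<bar> * indicator {a..b} s \<partial>lborel)"
    by (intro nn_integral_cong) (auto simp: f_def A_def gh split: split_indicator)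
  also have "\<dots> = (\<integral>\<^sup>+p. f p * indicator (h ` {a..b}) p \<partial>lborel)"
    by (rule nn_integral_substitution_abs[symmetric, OF f \<open>a < b\<close> der cont nz])
  also have "\<dots> = (\<integral>\<^sup>+p. f p \<partial>lborel)"
    by (intro nn_integral_cong) (auto simp: f_def A_def split: split_indicator)
  finally show "(\<integral>\<^sup>+s. k s * ennreal \<bar>h' s\<bar> * indicator {a..b} s \<partial>lborel) =
         (\<integral>\<^sup>+p. (\<integral>\<^sup>+s. k s * indicator {s \<in> {a..b}. h s = p} s \<partial>count_space UNIV) \<partial>lborel)"
    unfolding eq .
qed

text \<open>Critical points contribute nothing on the left and are excluded from the fibres on the
  right. What remains is open, hence a countable union of closed intervals without critical points;
  made disjoint, they reduce the claim to a single interval. Fibres may be infinite.\<close>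

lemma area_formula:
  fixes k :: "real \<Rightarrow> ennreal" and h h' :: "real \<Rightarrow> real"
  assumes k[measurable]: "k \<in> borel_measurable borel" and D: "open D"
    and der: "\<And>x. x \<in> D \<Longrightarrow> (h has_real_derivative h' x) (at x)"
    and cont: "continuous_on D h'" 
  shows "(\<integral>\<^sup>+s. k s * ennreal \<bar>h' s\<bar> * indicator D s \<partial>lborel) =
         (\<integral>\<^sup>+p. (\<integral>\<^sup>+s. k s \<partial>count_space {s \<in> D. h s = p \<and> h' s \<noteq> 0}) \<partial>lborel)"
proof -
  define W where "W = {s \<in> D. h' s \<noteq> 0}"
  have "open W"
    using continuous_open_preimage[OF cont D, of "- {0}"] by (simp add: open_Compl W_def vimage_def Int_def)
  \<comment> \<open>\<open>r\<close> enumerates all pairs of rationals; pairs that do not span an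
    interval inside \<open>W\<close> are given the empty set.\<close>
  define r where "r n = (from_nat n :: rat \<times> rat)" for n
  define lo hi where "lo n = (of_rat (fst (r n)) :: real)" and "hi n = (of_rat (snd (r n)) :: real)" for n
  define ok where "ok n \<longleftrightarrow> lo n < hi n \<and> {lo n..hi n} \<subseteq> W" for n
  define Q where "Q n = (if ok n then {lo n..hi n} else {})" for n
  have QW: "(\<Union>n. Q n) = W"
  proof
    show "(\<Union>n. Q n) \<subseteq> W" by (auto simp: Q_def ok_def)
    show "W \<subseteq> (\<Union>n. Q n)"
    proof
      fix x assume "x \<in> W"
      then obtain e where e: "e > 0" "ball x e \<subseteq> W" using \<open>open W\<close> open_contains_ball by blast
      obtain p where p: "x - e < of_rat p" "of_rat p < x" using of_rat_dense[of "x - e" x] e by auto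
      obtain q where q: "x < of_rat q" "of_rat q < x + e" using of_rat_dense[of x "x + e"] e by auto
      define n where "n = to_nat (p, q)"
      have n: "lo n = of_rat p" "hi n = of_rat q" by (simp_all add: n_def lo_def hi_def r_def)
      have "{lo n..hi n} \<subseteq> ball x e" using p q by (auto simp: n dist_real_def)
      then have "ok n" using p q e by (auto simp: ok_def n)
      then have "x \<in> Q n" using p q by (simp add: Q_def n)
      then show "x \<in> (\<Union>n. Q n)" by blast
    qed
  qed
  define B where "B = disjointed Q"
  have Bm[measurable]: "B n \<in> sets borel" for n
  proof -
    have "range Q \<subseteq> sets borel" by (auto simp: Q_def)
    then have "range B \<subseteq> sets borel" unfolding B_def by (rule sets.range_disjointed_sets)
    then show ?thesis by auto
  qed
  have Bdisj: "disjoint_family B" unfolding B_def by (rule disjoint_family_disjointed)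
  have BW: "(\<Union>n. B n) = W" unfolding B_def UN_disjointed_eq QW ..
  have BQ: "B n \<subseteq> Q n" for n unfolding B_def by (rule disjointed_subset)
  have Dm[measurable]: "D \<in> sets borel" using D by simp
  have h'm[measurable]: "(\<lambda>s. indicator D s *\<^sub>R h' s) \<in> borel_measurable borel"
    by (rule borel_measurable_continuous_on_indicator[OF Dm cont])
  let ?N = "\<lambda>n p. \<integral>\<^sup>+s. k s * indicator {s \<in> B n. h s = p} s \<partial>count_space UNIV"
  have piece: "(\<integral>\<^sup>+s. k s * ennreal \<bar>h' s\<bar> * indicator (B n) s \<partial>lborel) = (\<integral>\<^sup>+p. ?N n p \<partial>lborel)"
    "?N n \<in> borel_measurable borel" for n
  proof -
    have "(\<integral>\<^sup>+s. k s * ennreal \<bar>h' s\<bar> * indicator (B n) s \<partial>lborel) = (\<integral>\<^sup>+p. ?N n p \<partial>lborel) \<and> ?N n \<in> borel_measurable borel"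
    proof (cases "ok n")
      case True
      then have ab: "lo n < hi n" and sub: "{lo n..hi n} \<subseteq> W" and Q: "Q n = {lo n..hi n}" by (auto simp: ok_def Q_def)
      have sD: "{lo n..hi n} \<subseteq> D" using sub by (auto simp: W_def)
      have nz: "h' x \<noteq> 0" if "x \<in> {lo n..hi n}" for x using sub that by (auto simp: W_def)
      have c: "continuous_on {lo n..hi n} h'" using cont sD continuous_on_subset by blast
      have d: "(h has_real_derivative h' x) (at x)" if "x \<in> {lo n..hi n}" for x using der sD that by blast
      \<comment> \<open>The disjointed pieces need not be intervals, so the restriction to
        \<open>B n\<close> is absorbed into the weight and the formula is applied on all of
        \<open>Q n\<close>.\<close>
      have kB[measurable]: "(\<lambda>s. k s * indicator (B n) s) \<in> borel_measurable borel" by measurable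
      have 1: "(\<lambda>s. k s * indicator (B n) s * ennreal \<bar>h' s\<bar> * indicator {lo n..hi n} s) = (\<lambda>s. k s * ennreal \<bar>h' s\<bar> * indicator (B n) s)"
        using BQ[of n] unfolding Q by (intro ext) (auto split: split_indicator)
      have 2: "(\<lambda>s. k s * indicator (B n) s * indicator {s \<in> {lo n..hi n}. h s = p} s) = (\<lambda>s. k s * indicator {s \<in> B n. h s = p} s)" for p
        using BQ[of n] unfolding Q by (intro ext) (auto split: split_indicator)
      show ?thesis using area_formula_interval[OF kB ab d c nz] unfolding 1 2 by simp
    next
      case False
      then have "B n = {}" using BQ[of n] by (simp add: Q_def)
      then show ?thesis by simp
    qed
    then show "(\<integral>\<^sup>+s. k s * ennreal \<bar>h' s\<bar> * indicator (B n) s \<partial>lborel) = (\<integral>\<^sup>+p. ?N n p \<partial>lborel)"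
      "?N n \<in> borel_measurable borel" by auto
  qed
  have [measurable]: "(\<lambda>s. ennreal \<bar>h' s\<bar> * indicator (B n) s) \<in> borel_measurable borel" for n
  proof -
    have "(\<lambda>s. ennreal \<bar>h' s\<bar> * indicator (B n) s) = (\<lambda>s. ennreal \<bar>indicator D s *\<^sub>R h' s\<bar> * indicator (B n) s)"
      using BW by (intro ext) (auto simp: W_def split: split_indicator)
    also have "\<dots> \<in> borel_measurable borel" by measurable
    finally show ?thesis .
  qed
  have "(\<integral>\<^sup>+s. k s * ennreal \<bar>h' s\<bar> * indicator D s \<partial>lborel) = (\<integral>\<^sup>+s. k s * ennreal \<bar>h' s\<bar> * indicator W s \<partial>lborel)"
    by (intro nn_integral_cong) (auto simp: W_def split: split_indicator)
  also have "\<dots> = (\<integral>\<^sup>+s. (\<Sum>n. k s * (ennreal \<bar>h' s\<bar> * indicator (B n) s)) \<partial>lborel)"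
    by (intro nn_integral_cong) (simp add: BW[symmetric] suminf_indicator[OF Bdisj] mult.assoc)
  also have "\<dots> = (\<Sum>n. \<integral>\<^sup>+s. k s * (ennreal \<bar>h' s\<bar> * indicator (B n) s) \<partial>lborel)"
    by (rule nn_integral_suminf) measurable
  also have "\<dots> = (\<Sum>n. \<integral>\<^sup>+p. ?N n p \<partial>lborel)"
    by (simp add: piece(1)[symmetric] mult.assoc)
  also have "\<dots> = (\<integral>\<^sup>+p. (\<Sum>n. ?N n p) \<partial>lborel)"
    by (rule nn_integral_suminf[symmetric]) (use piece(2) in simp)
  also have "\<dots> = (\<integral>\<^sup>+p. (\<integral>\<^sup>+s. k s \<partial>count_space {s \<in> D. h s = p \<and> h' s \<noteq> 0}) \<partial>lborel)"
  proof (intro nn_integral_cong)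
    fix p
    have dj: "disjoint_family (\<lambda>n. {s \<in> B n. h s = p})" using Bdisj by (auto simp: disjoint_family_on_def)
    have un: "(\<Union>n. {s \<in> B n. h s = p}) = {s \<in> D. h s = p \<and> h' s \<noteq> 0}" using BW by (auto simp: W_def)
    have "(\<Sum>n. ?N n p) = (\<integral>\<^sup>+s. (\<Sum>n. k s * indicator {s \<in> B n. h s = p} s) \<partial>count_space UNIV)"
      by (rule nn_integral_suminf[symmetric]) simp
    also have "\<dots> = (\<integral>\<^sup>+s. k s * indicator {s \<in> D. h s = p \<and> h' s \<noteq> 0} s \<partial>count_space UNIV)"
      by (simp add: suminf_indicator[OF dj] un)
    also have "\<dots> = (\<integral>\<^sup>+s. k s \<partial>count_space {s \<in> D. h s = p \<and> h' s \<noteq> 0})"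
      by (simp add: nn_integral_count_space_indicator)
    finally show "(\<Sum>n. ?N n p) = (\<integral>\<^sup>+s. k s \<partial>count_space {s \<in> D. h s = p \<and> h' s \<noteq> 0})" .
  qed
  finally show ?thesis .
qed

section \<open>Symmetries of integrals over the circle of directions\<close>

lemma nn_integral_circle_rotate:
  fixes H :: "complex \<Rightarrow> ennreal"
  assumes H[measurable]: "H \<in> borel_measurable borel" and c: "norm c = 1"
  shows "(\<integral>\<^sup>+w. H (c * cis w) * indicator {0..<2*pi} w \<partial>lborel) = (\<integral>\<^sup>+w. H (cis w) * indicator {0..<2*pi} w \<partial>lborel)"
proof -
  define a where "a = Arg2pi c"
  have a: "0 \<le> a" "a < 2 * pi" "c = cis a"
    using Arg2pi[of c] c by (auto simp: a_def cis_conv_exp is_Arg_def)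
  have [measurable]: "cis \<in> borel_measurable borel"
    by (intro borel_measurable_continuous_onI continuous_intros)
  have "(\<integral>\<^sup>+w. H (cis w) * indicator {a..<a + 2*pi} w \<partial>lborel) = (\<integral>\<^sup>+w. H (cis (a + w)) * indicator {a..<a + 2*pi} (a + w) \<partial>lborel)"
    by (subst nn_integral_real_affine[of _ 1 a]) auto
  also have "\<dots> = (\<integral>\<^sup>+w. H (c * cis w) * indicator {0..<2*pi} w \<partial>lborel)"
    by (intro nn_integral_cong) (auto simp: a cis_mult split: split_indicator)
  finally have 1: "(\<integral>\<^sup>+w. H (c * cis w) * indicator {0..<2*pi} w \<partial>lborel) = (\<integral>\<^sup>+w. H (cis w) * indicator {a..<a + 2*pi} w \<partial>lborel)" ..
  \<comment> \<open>The window of length \<open>2 * pi\<close> starting at \<open>a\<close> is cut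
    at \<open>2 * pi\<close>, and the excess is moved back by periodicity.\<close>
  have "\<dots> = (\<integral>\<^sup>+w. H (cis w) * indicator {a..<2*pi} w + H (cis w) * indicator {2*pi..<a + 2*pi} w \<partial>lborel)"
    by (intro nn_integral_cong) (use a in \<open>auto split: split_indicator\<close>)
  also have "\<dots> = (\<integral>\<^sup>+w. H (cis w) * indicator {a..<2*pi} w \<partial>lborel) + (\<integral>\<^sup>+w. H (cis w) * indicator {2*pi..<a + 2*pi} w \<partial>lborel)"
    by (rule nn_integral_add) auto
  also have "(\<integral>\<^sup>+w. H (cis w) * indicator {2*pi..<a + 2*pi} w \<partial>lborel) = (\<integral>\<^sup>+w. H (cis (2*pi + w)) * indicator {2*pi..<a + 2*pi} (2*pi + w) \<partial>lborel)"
    by (subst nn_integral_real_affine[of _ 1 "2*pi"]) auto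
  also have "\<dots> = (\<integral>\<^sup>+w. H (cis w) * indicator {0..<a} w \<partial>lborel)"
    by (intro nn_integral_cong) (auto simp: cis_mult[symmetric] split: split_indicator)
  also have "(\<integral>\<^sup>+w. H (cis w) * indicator {a..<2*pi} w \<partial>lborel) + (\<integral>\<^sup>+w. H (cis w) * indicator {0..<a} w \<partial>lborel)
     = (\<integral>\<^sup>+w. H (cis w) * indicator {a..<2*pi} w + H (cis w) * indicator {0..<a} w \<partial>lborel)"
    by (rule nn_integral_add[symmetric]) auto
  also have "\<dots> = (\<integral>\<^sup>+w. H (cis w) * indicator {0..<2*pi} w \<partial>lborel)"
    by (intro nn_integral_cong) (use a in \<open>auto split: split_indicator\<close>)
  finally show ?thesis using 1 by simp
qed

lemma nn_integral_circle_cnj: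
  fixes H :: "complex \<Rightarrow> ennreal"
  assumes H[measurable]: "H \<in> borel_measurable borel"
  shows "(\<integral>\<^sup>+w. H (cnj (cis w)) * indicator {0..<2*pi} w \<partial>lborel) = (\<integral>\<^sup>+w. H (cis w) * indicator {0..<2*pi} w \<partial>lborel)"
proof -
  have [measurable]: "cis \<in> borel_measurable borel"
    by (intro borel_measurable_continuous_onI continuous_intros)
  have "(\<integral>\<^sup>+w. H (cis w) * indicator {0..<2*pi} w \<partial>lborel) = (\<integral>\<^sup>+w. H (cis (2*pi - w)) * indicator {0..<2*pi} (2*pi - w) \<partial>lborel)"
    by (subst nn_integral_real_affine[of _ "-1" "2*pi"]) auto
  also have "\<dots> = (\<integral>\<^sup>+w. H (cnj (cis w)) * indicator {0..<2*pi} w \<partial>lborel)"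
  proof (rule nn_integral_cong_AE)
    \<comment> \<open>The reflection turns the half-open interval into one that is open at 0 and
      closed at \<open>2 * pi\<close>; the indicators differ at these two points only.\<close>
    have "AE w in lborel. w \<noteq> 0" "AE w in lborel. w \<noteq> 2 * pi" by (auto intro: AE_lborel_singleton)
    then show "AE w in lborel. H (cis (2*pi - w)) * indicator {0..<2*pi} (2*pi - w) = H (cnj (cis w)) * indicator {0..<2*pi} w"
    proof eventually_elim
      fix w :: real assume "w \<noteq> 0" "w \<noteq> 2 * pi"
      then have "indicator {0..<2*pi} (2*pi - w) = (indicator {0..<2*pi} w :: ennreal)"
        by (auto split: split_indicator)
      moreover have "cis (2*pi - w) = cnj (cis w)" by (simp add: complex_eq_iff)
      ultimately show "H (cis (2*pi - w)) * indicator {0..<2*pi} (2*pi - w) = H (cnj (cis w)) * indicator {0..<2*pi} w"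
        by simp
    qed
  qed
  finally show ?thesis ..
qed

section \<open>The boundary curve\<close>

lemma Ln_minus_lower_upper:
  "Im z < 0 \<Longrightarrow> Ln (- z) = Ln z + \<i> * pi" "Im z > 0 \<Longrightarrow> Ln (- z) = Ln z - \<i> * pi"
  by (subst Ln_minus; force)+

text \<open>For a base point just ahead of (behind) the crossing, the short arc avoids the half line from
  that point in direction \<open>d\<close> (\<open>- d\<close>), so its winding number is given by a branch of the logarithm;
  the two branches differ by \<open>2\<pi>\<i>\<close>.\<close>

lemma winding_number_jump:
  fixes g :: "real \<Rightarrow> complex"
  assumes g: "valid_path g" and uv: "0 \<le> u" "u \<le> v" "v \<le> 1" and d: "d \<noteq> 0"
    and cross: "\<And>x. x \<in> {u..v} \<Longrightarrow> Im ((g x - w) / d) = 0 \<Longrightarrow> g x = w"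
    and gu: "Im ((g u - w) / d) > 0" and gv: "Im ((g v - w) / d) < 0"
    and away: "\<And>x. x \<in> {0..u} \<union> {v..1} \<Longrightarrow> g x \<noteq> w"
    and off: "\<forall>\<^sub>F t in at_right 0. w + of_real t * d \<notin> path_image g \<and> w - of_real t * d \<notin> path_image g"
  shows "((\<lambda>t. winding_number g (w + of_real t * d) - winding_number g (w - of_real t * d)) \<longlongrightarrow> 1) (at_right 0)"
proof -
  define l where "l = subpath 0 u g"
  define m where "m = subpath u v g"
  define r where "r = subpath v 1 g"
  have pg: "path g" using g by (rule valid_path_imp_path)
  have paths: "path l" "path r" "valid_path m"
    using uv pg g by (auto simp: l_def r_def m_def intro!: path_subpath valid_path_subpath)
  have im: "path_image l = g ` {0..u}" "path_image r = g ` {v..1}" "path_image m = g ` {u..v}"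
    using uv by (simp_all add: l_def r_def m_def path_image_subpath)
  have sub: "path_image m \<subseteq> path_image g"
    unfolding im(3) unfolding path_image_def using uv by (intro image_mono) auto
  have wl: "w \<notin> path_image l" and wr: "w \<notin> path_image r" using away unfolding im by blast+
  have split: "winding_number g z = winding_number l z + winding_number m z + winding_number r z"
    if "z \<notin> path_image g" for z
  proof -
    have "winding_number l z + winding_number m z = winding_number (subpath 0 v g) z"
      unfolding l_def m_def by (rule winding_number_subpath_combine) (use that pg uv in auto)
    moreover have "winding_number (subpath 0 v g) z + winding_number r z = winding_number (subpath 0 1 g) z"
      unfolding r_def by (rule winding_number_subpath_combine) (use that pg uv in auto)
    ultimately show ?thesis by simp
  qed
  define A where "A = (g u - w) / d"
  define B where "B = (g v - w) / d"
  have plus: "winding_number m (w + of_real t * d) = (Ln (of_real t - B) - Ln (of_real t - A)) / (2 * pi * \<i>)"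
    if t: "t > 0" and nin: "w + of_real t * d \<notin> path_image g" for t
  proof -
    define z where "z = w + of_real t * d"
    have nin': "z \<notin> path_image m" using nin sub by (auto simp: z_def)
    have "((\<lambda>x. 1 / (x - z)) has_contour_integral (Ln (of_real t - (pathfinish m - w) / d) - Ln (of_real t - (pathstart m - w) / d))) m"
    proof (rule contour_integral_primitive[of "path_image m" "\<lambda>x. Ln (of_real t - (x - w) / d)"])
      fix x assume "x \<in> path_image m"
      then obtain y where y: "y \<in> {u..v}" "x = g y" by (auto simp: im)
      \<comment> \<open>On the branch cut \<open>(x - w) / d\<close> would be real. On the short arc
        this happens only at \<open>w\<close>, where the argument of \<open>Ln\<close> is the
        positive number \<open>t\<close>.\<close>
      have "of_real t - (x - w) / d \<notin> \<real>\<^sub>\<le>\<^sub>0"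
      proof
        assume a: "of_real t - (x - w) / d \<in> \<real>\<^sub>\<le>\<^sub>0"
        then have "Im ((x - w) / d) = 0" by (auto simp: complex_nonpos_Reals_iff)
        then have "x = w" using cross y by simp
        then show False using a t by (simp add: complex_nonpos_Reals_iff)
      qed
      moreover have "- (1 / d) / (of_real t - (x - w) / d) = 1 / (x - z)"
        using d by (cases "x = z") (auto simp: z_def field_simps)
      ultimately show "((\<lambda>x. Ln (of_real t - (x - w) / d)) has_field_derivative 1 / (x - z)) (at x within path_image m)"
        by (auto intro!: derivative_eq_intros simp: divide_inverse mult.commute)
    qed (use paths in auto)
    then have "contour_integral m (\<lambda>x. 1 / (x - z)) = Ln (of_real t - B) - Ln (of_real t - A)"
      by (simp add: contour_integral_unique m_def A_def B_def)
    then show ?thesis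
      unfolding z_def[symmetric] by (simp add: winding_number_valid_path[OF paths(3) nin'])
  qed
  have minus: "winding_number m (w - of_real t * d) = (Ln (B + of_real t) - Ln (A + of_real t)) / (2 * pi * \<i>)"
    if t: "t > 0" and nin: "w - of_real t * d \<notin> path_image g" for t
  proof -
    define z where "z = w - of_real t * d"
    have nin': "z \<notin> path_image m" using nin sub by (auto simp: z_def)
    have "((\<lambda>x. 1 / (x - z)) has_contour_integral (Ln ((pathfinish m - w) / d + of_real t) - Ln ((pathstart m - w) / d + of_real t))) m"
    proof (rule contour_integral_primitive[of "path_image m" "\<lambda>x. Ln ((x - w) / d + of_real t)"])
      fix x assume "x \<in> path_image m"
      then obtain y where y: "y \<in> {u..v}" "x = g y" by (auto simp: im)
      have "(x - w) / d + of_real t \<notin> \<real>\<^sub>\<le>\<^sub>0"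
      proof
        assume a: "(x - w) / d + of_real t \<in> \<real>\<^sub>\<le>\<^sub>0"
        then have "Im ((x - w) / d) = 0" by (auto simp: complex_nonpos_Reals_iff)
        then have "x = w" using cross y by simp
        then show False using a t by (simp add: complex_nonpos_Reals_iff)
      qed
      moreover have "(1 / d) / ((x - w) / d + of_real t) = 1 / (x - z)"
        using d by (cases "x = z") (auto simp: z_def field_simps)
      ultimately show "((\<lambda>x. Ln ((x - w) / d + of_real t)) has_field_derivative 1 / (x - z)) (at x within path_image m)"
        by (auto intro!: derivative_eq_intros simp: divide_inverse mult.commute)
    qed (use paths in auto)
    then have "contour_integral m (\<lambda>x. 1 / (x - z)) = Ln (B + of_real t) - Ln (A + of_real t)"
      by (simp add: contour_integral_unique m_def A_def B_def)
    then show ?thesis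
      unfolding z_def[symmetric] by (simp add: winding_number_valid_path[OF paths(3) nin'])
  qed
  \<comment> \<open>A formula that makes sense for all \<open>t\<close>, so that the limit can be
    taken termwise: the outer arcs avoid \<open>w\<close>, their differences tend to 0, and the
    logarithms remain.\<close>
  define G where "G t = (winding_number l (w + of_real t * d) - winding_number l (w - of_real t * d))
     + (winding_number r (w + of_real t * d) - winding_number r (w - of_real t * d))
     + ((Ln (of_real t - B) - Ln (of_real t - A)) / (2 * pi * \<i>) - (Ln (B + of_real t) - Ln (A + of_real t)) / (2 * pi * \<i>))" for t :: real
  have ImA: "Im A > 0" and ImB: "Im B < 0" using gu gv by (simp_all add: A_def B_def)
  have nonreal: "- A \<notin> \<real>\<^sub>\<le>\<^sub>0" "- B \<notin> \<real>\<^sub>\<le>\<^sub>0" "A \<notin> \<real>\<^sub>\<le>\<^sub>0" "B \<notin> \<real>\<^sub>\<le>\<^sub>0"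
    using ImA ImB by (auto simp: complex_nonpos_Reals_iff)
  have t0: "((\<lambda>t. of_real t :: complex) \<longlongrightarrow> 0) (at_right 0)"
    using tendsto_of_real[OF tendsto_ident_at[of 0 "{0<..}"]] by simp
  have tp: "((\<lambda>t. w + of_real t * d) \<longlongrightarrow> w) (at_right 0)" and tm: "((\<lambda>t. w - of_real t * d) \<longlongrightarrow> w) (at_right 0)"
    using tendsto_add[OF tendsto_const[of w] tendsto_mult[OF t0 tendsto_const[of d]]]
      tendsto_diff[OF tendsto_const[of w] tendsto_mult[OF t0 tendsto_const[of d]]] by simp_all
  have wn_lim: "((\<lambda>t. winding_number p (w + of_real t * d)) \<longlongrightarrow> winding_number p w) (at_right 0)"
      "((\<lambda>t. winding_number p (w - of_real t * d)) \<longlongrightarrow> winding_number p w) (at_right 0)"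
    if "path p" "w \<notin> path_image p" for p
    using continuous_at_winding_number[OF that]
    by (auto intro: isCont_tendsto_compose[OF _ tp] isCont_tendsto_compose[OF _ tm])
  have Ln_lim: "((\<lambda>t. Ln (of_real t - B)) \<longlongrightarrow> Ln (- B)) (at_right 0)"
     "((\<lambda>t. Ln (of_real t - A)) \<longlongrightarrow> Ln (- A)) (at_right 0)"
     "((\<lambda>t. Ln (B + of_real t)) \<longlongrightarrow> Ln B) (at_right 0)"
     "((\<lambda>t. Ln (A + of_real t)) \<longlongrightarrow> Ln A) (at_right 0)"
    using tendsto_diff[OF t0 tendsto_const[of B]] tendsto_diff[OF t0 tendsto_const[of A]]
      tendsto_add[OF tendsto_const[of B] t0] tendsto_add[OF tendsto_const[of A] t0] nonreal
    by (auto intro!: tendsto_Ln)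
  have "(G \<longlongrightarrow> (winding_number l w - winding_number l w) + (winding_number r w - winding_number r w)
     + ((Ln (- B) - Ln (- A)) / (2 * pi * \<i>) - (Ln B - Ln A) / (2 * pi * \<i>))) (at_right 0)"
    unfolding G_def
    by (intro tendsto_add tendsto_diff tendsto_divide tendsto_const wn_lim[OF paths(1) wl] wn_lim[OF paths(2) wr] Ln_lim) auto
  \<comment> \<open>Passing from \<open>B\<close> to \<open>- B\<close> adds
    \<open>\<i> * pi\<close> to the logarithm and passing from \<open>A\<close> to
    \<open>- A\<close> subtracts it; together they make one full turn.\<close>
  also have "(winding_number l w - winding_number l w) + (winding_number r w - winding_number r w)
     + ((Ln (- B) - Ln (- A)) / (2 * pi * \<i>) - (Ln B - Ln A) / (2 * pi * \<i>)) = 1"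
    unfolding Ln_minus_lower_upper(1)[OF ImB] Ln_minus_lower_upper(2)[OF ImA] diff_divide_distrib[symmetric]
    by simp
  finally have "(G \<longlongrightarrow> 1) (at_right 0)" .
  moreover have "\<forall>\<^sub>F t in at_right 0. G t = winding_number g (w + of_real t * d) - winding_number g (w - of_real t * d)"
    using off eventually_at_right_less[of 0]
    by eventually_elim (simp add: G_def split plus minus)
  ultimately show ?thesis by (rule Lim_transform_eventually)
qed

section \<open>Regularity and measurability of the boundary parametrization\<close>

locale smooth_boundary =
  fixes \<gamma> :: "real \<Rightarrow> complex" and L :: real and K :: "real set"
  assumes L_pos: "L > 0" and periodic: "\<And>s. \<gamma> (s + L) = \<gamma> s"
    and K: "finite K" "0 \<in> K" "L \<in> K" "K \<subseteq> {0..L}"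
    and pieces: "\<And>a b. a \<in> K \<Longrightarrow> b \<in> K \<Longrightarrow> a < b \<Longrightarrow> {a<..<b} \<inter> K = {} \<Longrightarrow>
       \<exists>g. smooth_real_fun g \<and> (\<forall>s\<in>{a..b}. \<gamma> s = g s \<and> norm (vector_derivative g (at s)) = 1)"
begin

abbreviation "T \<equiv> tangent \<gamma>"

definition "U = {0<..<L} - K"

lemma open_U: "open U"
  unfolding U_def by (intro open_Diff finite_imp_closed K) simp

text \<open>The claims on \<open>T\<close> are for half-open intervals because
  \<open>tangent\<close> is a right derivative: at the right end of a piece the next piece
  decides.\<close>

lemma piece:
  assumes "a \<in> K" "b \<in> K" "a < b" "{a<..<b} \<inter> K = {}"
  obtains g g' where "\<And>x. (g has_vector_derivative g' x) (at x)" "continuous_on UNIV g'"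
    "\<And>x. x \<in> {a..b} \<Longrightarrow> \<gamma> x = g x" "\<And>x. x \<in> {a..b} \<Longrightarrow> norm (g' x) = 1"
    "\<And>x. x \<in> {a..<b} \<Longrightarrow> T x = g' x" 
    "\<And>x. x \<in> {a..<b} \<Longrightarrow> (\<gamma> has_vector_derivative g' x) (at x within {x..})"
proof -
  obtain g where g: "smooth_real_fun g" "\<And>s. s \<in> {a..b} \<Longrightarrow> \<gamma> s = g s \<and> norm (vector_derivative g (at s)) = 1"
    using pieces[OF assms] by blast
  then obtain D where D: "D 0 = g" "\<And>n x. (D n has_vector_derivative D (Suc n) x) (at x)"
    unfolding smooth_real_fun_def by blast
  have g': "(g has_vector_derivative D 1 x) (at x)" for x using D(2)[of 0 x] D(1) by simp
  have vd: "vector_derivative g (at x) = D 1 x" for x using g' by (rule vector_derivative_at)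
  have cont: "continuous_on UNIV (D 1)"
    by (intro continuous_at_imp_continuous_on ballI has_vector_derivative_continuous[OF D(2)])
  have right: "(\<gamma> has_vector_derivative D 1 x) (at x within {x..})" if "x \<in> {a..<b}" for x
  proof (rule has_vector_derivative_transform_within)
    show "(g has_vector_derivative D 1 x) (at x within {x..})" using g' by (rule has_vector_derivative_at_within)
    show "0 < b - x" using that by simp
    show "g x' = \<gamma> x'" if "x' \<in> {x..}" "dist x' x < b - x" for x'
      using that \<open>x \<in> {a..<b}\<close> g(2)[of x'] by (auto simp: dist_real_def)
  qed simp
  have "T x = D 1 x" if "x \<in> {a..<b}" for x
    unfolding tangent_def by (rule vector_derivative_within[OF _ right[OF that]])
      (simp add: at_within_Ici_at_right)
  then show thesis using that[OF g' cont _ _ _ right] g(2) vd by auto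
qed

lemma consecutive:
  assumes "s \<in> {0..<L}"
  obtains a b where "a \<in> K" "b \<in> K" "a \<le> s" "s < b" "{a<..<b} \<inter> K = {}"
proof -
  let ?A = "{x \<in> K. x \<le> s}" and ?B = "{x \<in> K. s < x}"
  have fin: "finite ?A" "finite ?B" and ne: "?A \<noteq> {}" "?B \<noteq> {}" using K assms by auto
  have "Max ?A \<in> ?A" "Min ?B \<in> ?B" using fin ne Max_in Min_in by blast+
  moreover have "{Max ?A<..<Min ?B} \<inter> K = {}"
  proof (rule ccontr)
    assume "\<not> ?thesis"
    then obtain x where x: "x \<in> K" "Max ?A < x" "x < Min ?B" by auto
    then show False using Max_ge[OF fin(1), of x] Min_le[OF fin(2), of x] by (cases "x \<le> s") auto
  qed
  ultimately show thesis using that by auto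
qed

lemma right_derivative: "(\<gamma> has_vector_derivative T s) (at s within {s..})" if s: "s \<in> {0..<L}"
proof -
  obtain a b where ab: "a \<in> K" "b \<in> K" "a \<le> s" "s < b" "{a<..<b} \<inter> K = {}" using consecutive[OF s] .
  then have "a < b" by simp
  from piece[OF ab(1,2) this ab(5)] ab show ?thesis by (metis atLeastLessThan_iff)
qed

lemma
  assumes s: "s \<in> U"
  shows derivative_U: "(\<gamma> has_vector_derivative T s) (at s)"
    and norm_T: "norm (T s) = 1"
    and isCont_T: "isCont T s"
proof -
  have sL: "s \<in> {0..<L}" using s by (auto simp: U_def)
  obtain a b where ab: "a \<in> K" "b \<in> K" "a \<le> s" "s < b" "{a<..<b} \<inter> K = {}" using consecutive[OF sL] .
  have as: "a < s" using ab s by (auto simp: U_def order.order_iff_strict)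
  then have lt: "a < b" using ab by simp
  obtain g g' where g: "\<And>x. (g has_vector_derivative g' x) (at x)" "continuous_on UNIV g'"
    "\<And>x. x \<in> {a..b} \<Longrightarrow> \<gamma> x = g x" "\<And>x. x \<in> {a..b} \<Longrightarrow> norm (g' x) = 1"
    "\<And>x. x \<in> {a..<b} \<Longrightarrow> T x = g' x" using piece[OF ab(1,2) lt ab(5)] by metis
  show "(\<gamma> has_vector_derivative T s) (at s)"
    using has_vector_derivative_transform_within_open[OF g(1), of "{a<..<b}" s \<gamma>] g(3,5) as ab by auto
  show "norm (T s) = 1" using g(4,5) as ab by auto
  have "isCont g' s" using g(2) by (simp add: continuous_on_eq_continuous_at)
  moreover have "\<forall>\<^sub>F x in nhds s. T x = g' x"
    using eventually_nhds_in_open[of "{a<..<b}" s] as ab g(5) by (auto elim!: eventually_mono)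
  ultimately show "isCont T s" by (simp add: isCont_cong)
qed

lemma continuous_on_T: "continuous_on U T"
  using isCont_T continuous_at_imp_continuous_on by blast

lemma continuous_boundary: "continuous_on {0..L} \<gamma>"
proof -
  define P where "P = {q \<in> K \<times> K. fst q < snd q \<and> {fst q<..<snd q} \<inter> K = {}}"
  have fin: "finite P" unfolding P_def using K(1) by auto
  have "continuous_on (\<Union>q\<in>P. {fst q..snd q}) \<gamma>"
  proof (rule continuous_on_closed_Union[OF fin])
    fix q assume q: "q \<in> P"
    obtain g g' where g: "\<And>x. (g has_vector_derivative g' x) (at x)"
      "\<And>x. x \<in> {fst q..snd q} \<Longrightarrow> \<gamma> x = g x"
      using q piece[of "fst q" "snd q"] unfolding P_def mem_Collect_eq mem_Times_iff by metis
    have "continuous_on {fst q..snd q} g"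
      by (intro continuous_at_imp_continuous_on ballI has_vector_derivative_continuous[OF g(1)])
    then show "continuous_on {fst q..snd q} \<gamma>" using g(2) by (simp cong: continuous_on_cong_simp)
  qed simp
  moreover have "{0..L} \<subseteq> (\<Union>q\<in>P. {fst q..snd q})"
  proof
    fix s assume s: "s \<in> {0..L}"
    show "s \<in> (\<Union>q\<in>P. {fst q..snd q})"
    proof (cases "s = L")
      case False
      then have sL: "s \<in> {0..<L}" using s by auto
      obtain a b where ab: "a \<in> K" "b \<in> K" "a \<le> s" "s < b" "{a<..<b} \<inter> K = {}" using consecutive[OF sL] .
      then show ?thesis by (intro UN_I[of "(a, b)"]) (auto simp: P_def)
    next
      \<comment> \<open>\<open>consecutive\<close> reaches only points below \<open>L\<close>; the
        end point lies in the last interval, which starts at the largest element of \<open>K\<close>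
        other than \<open>L\<close>.\<close>
      case True
      let ?A = "K - {L}"
      have fA: "finite ?A" "?A \<noteq> {}" using K L_pos by auto
      have "Max ?A \<in> ?A" by (rule Max_in[OF fA])
      then have a: "Max ?A \<in> K" "Max ?A < L" using K(4) by (auto simp: order.order_iff_strict)
      have "{Max ?A<..<L} \<inter> K = {}"
      proof (rule ccontr)
        assume "\<not> ?thesis"
        then obtain x where "x \<in> K" "Max ?A < x" "x < L" by auto
        then show False using Max_ge[OF fA(1), of x] by auto
      qed
      then show ?thesis using a K True by (intro UN_I[of "(Max ?A, L)"]) (auto simp: P_def)
    qed
  qed
  ultimately show ?thesis by (rule continuous_on_subset)
qed

lemma periodic_int: "\<gamma> (s - of_int k * L) = \<gamma> s"
proof -
  have nat: "\<gamma> (s + of_nat n * L) = \<gamma> s" for n s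
  proof (induction n)
    case (Suc n)
    then show ?case using periodic[of "s + of_nat n * L"] by (simp add: algebra_simps)
  qed simp
  show ?thesis
  proof (cases "k \<ge> 0")
    case True
    then show ?thesis using nat[of "s - of_int k * L" "nat k"] by simp
  next
    case False
    then show ?thesis using nat[of s "nat (- k)"] by simp
  qed
qed

text \<open>The representative modulo \<open>L\<close>. Through it, Borel measurability of
  \<open>\<gamma>\<close> and \<open>T\<close> on one period extends to the whole line, as is needed
  for a billiard map that is Borel on the whole plane.\<close>

definition reduce :: "real \<Rightarrow> real" where "reduce s = s - of_int \<lfloor>s / L\<rfloor> * L"

lemma reduce_range: "reduce s \<in> {0..<L}"
proof -
  have "of_int \<lfloor>s / L\<rfloor> \<le> s / L" "s / L < of_int \<lfloor>s / L\<rfloor> + 1" by linarith+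
  then have "of_int \<lfloor>s / L\<rfloor> * L \<le> s" "s < (of_int \<lfloor>s / L\<rfloor> + 1) * L"
    using L_pos pos_le_divide_eq pos_divide_less_eq by blast+
  then show ?thesis by (simp add: reduce_def algebra_simps)
qed

lemma boundary_reduce: "\<gamma> s = \<gamma> (reduce s)"
  by (simp add: reduce_def periodic_int)

lemma T_reduce: "T s = T (reduce s)"
proof -
  define c where "c = of_int \<lfloor>s / L\<rfloor> * L"
  have "(\<gamma> has_vector_derivative T (s - c)) (at (s - c) within (\<lambda>x. x - c) ` {s..})"
  proof -
    have "(\<lambda>x. x - c) ` {s..} = {s - c..}" by (force simp: image_iff intro: bexI[of _ "_ + c"])
    then show ?thesis using right_derivative[OF reduce_range[of s]] by (simp add: reduce_def c_def)
  qed
  moreover have "((\<lambda>x. x - c) has_vector_derivative 1) (at s within {s..})"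
    using has_vector_derivative_diff[OF has_vector_derivative_id has_vector_derivative_const] by simp
  ultimately have "(\<gamma> \<circ> (\<lambda>x. x - c) has_vector_derivative T (s - c)) (at s within {s..})"
    using vector_diff_chain_within by fastforce
  moreover have "\<gamma> \<circ> (\<lambda>x. x - c) = \<gamma>" by (auto simp: c_def periodic_int)
  ultimately have "(\<gamma> has_vector_derivative T (s - c)) (at s within {s..})" by simp
  then have "T s = T (s - c)" unfolding tangent_def[of \<gamma> s]
    by (intro vector_derivative_within) (simp_all add: at_within_Ici_at_right)
  then show ?thesis by (simp add: reduce_def c_def)
qed

lemma reduce_meas[measurable]: "reduce \<in> borel_measurable borel"
  unfolding reduce_def[abs_def] by measurable

lemma boundary_meas[measurable]: "\<gamma> \<in> borel_measurable borel"
proof -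
  have "(\<lambda>s. indicator {0..L} s *\<^sub>R \<gamma> s) \<in> borel_measurable borel"
    by (rule borel_measurable_continuous_on_indicator[OF _ continuous_boundary]) simp
  then have "(\<lambda>s. (\<lambda>s. indicator {0..L} s *\<^sub>R \<gamma> s) (reduce s)) \<in> borel_measurable borel" by measurable
  also have "(\<lambda>s. (\<lambda>s. indicator {0..L} s *\<^sub>R \<gamma> s) (reduce s)) = \<gamma>"
    using reduce_range boundary_reduce by (auto simp: indicator_def fun_eq_iff less_imp_le)
  finally show ?thesis .
qed

lemma T_meas[measurable]: "T \<in> borel_measurable borel"
proof -
  have "(\<lambda>s. indicator U s *\<^sub>R T s) \<in> borel_measurable borel"
    by (rule borel_measurable_continuous_on_indicator[OF _ continuous_on_T]) (use open_U in simp)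
  \<comment> \<open>Only points of the finite set \<open>K\<close> distinguish this function from
    the previous one.\<close>
  then have "(\<lambda>s. indicator {0..<L} s *\<^sub>R T s) \<in> borel_measurable borel"
    by (rule measurable_discrete_difference[where X = K])
      (use K in \<open>auto simp: countable_finite U_def indicator_def order.order_iff_strict\<close>)
  then have "(\<lambda>s. (\<lambda>s. indicator {0..<L} s *\<^sub>R T s) (reduce s)) \<in> borel_measurable borel" by measurable
  also have "(\<lambda>s. (\<lambda>s. indicator {0..<L} s *\<^sub>R T s) (reduce s)) = T"
    using reduce_range T_reduce by (auto simp: indicator_def fun_eq_iff)
  finally show ?thesis .
qed

end

section \<open>The table enclosed by the curve and its two sides\<close>

locale billiard_table = smooth_boundary \<gamma> L K for \<gamma> L K +
  fixes \<Omega> :: "complex set"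
  assumes open_table: "open \<Omega>" and bounded_table: "bounded \<Omega>"
    and inj: "inj_on \<gamma> {0..<L}" and frontier_table: "frontier \<Omega> = \<gamma> ` {0..L}"
    and winding: "\<And>w. w \<in> \<Omega> \<Longrightarrow> winding_number (boundary_path \<gamma> L) w = 1"
begin

definition "\<Gamma> = \<gamma> ` {0..L}"

lemma boundary_closed_up: "\<gamma> L = \<gamma> 0"
  using periodic[of 0] by simp

lemma boundary_half_open: "\<Gamma> = \<gamma> ` {0..<L}"
proof -
  have "{0..L} = insert L {0..<L}" using L_pos by auto
  moreover have "\<gamma> L \<in> \<gamma> ` {0..<L}" using boundary_closed_up L_pos by force
  ultimately show ?thesis unfolding \<Gamma>_def by auto
qed

lemma compact_boundary: "compact \<Gamma>"
  unfolding \<Gamma>_def by (intro compact_continuous_image continuous_boundary) simp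

lemma path_image_boundary: "path_image (boundary_path \<gamma> L) = \<Gamma>"
proof -
  have "(*) L ` {0..1} = {0..L}" using image_mult_atLeastAtMost[OF L_pos, of 0 1] by simp
  moreover have "path_image (boundary_path \<gamma> L) = \<gamma> ` (*) L ` {0..1}"
    by (simp add: path_image_def boundary_path_def image_image)
  ultimately show ?thesis by (simp add: \<Gamma>_def)
qed

lemma scale_mem: "x \<in> {0..1} \<Longrightarrow> L * x \<in> {0..L}"
  using L_pos by (simp add: mult_left_le)

lemma continuous_boundary_path: "continuous_on {0..1} (boundary_path \<gamma> L)"
  unfolding boundary_path_def
  by (rule continuous_on_compose2[OF continuous_boundary]) (use scale_mem in \<open>auto intro!: continuous_intros\<close>)

lemma valid_boundary_path: "valid_path (boundary_path \<gamma> L)"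
proof -
  have fin: "finite ((\<lambda>x. x / L) ` K)" using K by simp
  have U: "L * x \<in> U" if "x \<in> {0..1} - (\<lambda>x. x / L) ` K" for x
  proof -
    have "L * x \<notin> K" using that L_pos by (auto simp: image_iff)
    then show ?thesis using scale_mem[of x] that K by (auto simp: U_def order.order_iff_strict)
  qed
  have "boundary_path \<gamma> L C1_differentiable_on ({0..1} - (\<lambda>x. x / L) ` K)"
    unfolding C1_differentiable_on_def
  proof (intro exI conjI ballI)
    fix x assume x: "x \<in> {0..1} - (\<lambda>x. x / L) ` K"
    have "((\<lambda>x. L * x) has_vector_derivative L) (at x)"
      by (auto intro!: derivative_eq_intros simp flip: has_real_derivative_iff_has_vector_derivative)
    from vector_diff_chain_at[OF this derivative_U[OF U[OF x]]]
    show "(boundary_path \<gamma> L has_vector_derivative L *\<^sub>R T (L * x)) (at x)"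
      by (simp add: boundary_path_def comp_def)
  next
    show "continuous_on ({0..1} - (\<lambda>x. x / L) ` K) (\<lambda>x. L *\<^sub>R T (L * x))"
      by (intro continuous_intros continuous_on_compose2[OF continuous_on_T]) (use U in auto)
  qed
  then show ?thesis
    unfolding valid_path_def piecewise_C1_differentiable_on_def
    using continuous_boundary_path fin by blast
qed

lemma simple_boundary_path: "simple_path (boundary_path \<gamma> L)"
proof -
  have "x = y \<or> x = 0 \<and> y = 1 \<or> x = 1 \<and> y = 0"
    if xy: "x \<in> {0..1}" "y \<in> {0..1}" and eq: "\<gamma> (L * x) = \<gamma> (L * y)" for x y
  proof -
    define f where "f x = (if x = 1 then 0 else L * x)" for x
    have f: "f x \<in> {0..<L}" "\<gamma> (L * x) = \<gamma> (f x)" if "x \<in> {0..1}" for x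
      using that L_pos boundary_closed_up by (auto simp: f_def)
    have "f x = f y" using inj f[OF xy(1)] f[OF xy(2)] eq by (metis inj_onD)
    then show ?thesis using L_pos by (auto simp: f_def split: if_splits)
  qed
  then show ?thesis
    using continuous_boundary_path by (auto simp: simple_path_def loop_free_def path_def boundary_path_def)
qed

text \<open>The table is the inside of a Jordan curve. It lies in the inside because winding numbers
  vanish on the outside; conversely the inside is connected and does not meet the frontier of the
  table, so it cannot reach beyond the table.\<close>

lemma winding_number_off_boundary:
  assumes "w \<notin> \<Gamma>"
  shows "winding_number (boundary_path \<gamma> L) w = (if w \<in> \<Omega> then 1 else 0)"
proof -
  let ?p = "boundary_path \<gamma> L"
  have loop: "pathfinish ?p = pathstart ?p"
    by (simp add: pathfinish_def pathstart_def boundary_path_def boundary_closed_up)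
  have J: "connected (inside \<Gamma>)" "inside \<Gamma> \<inter> outside \<Gamma> = {}" "inside \<Gamma> \<union> outside \<Gamma> = - \<Gamma>"
    using Jordan_inside_outside[OF simple_boundary_path loop] by (auto simp: path_image_boundary)
  have out: "winding_number ?p z = 0" if "z \<in> outside \<Gamma>" for z
    using winding_number_zero_in_outside[OF valid_path_imp_path[OF valid_boundary_path] loop] that
    by (simp add: path_image_boundary)
  have fr: "frontier \<Omega> = \<Gamma>" using frontier_table by (simp add: \<Gamma>_def)
  have disj: "\<Omega> \<inter> \<Gamma> = {}" using open_table frontier_disjoint_eq fr by blast
  have "\<Omega> \<subseteq> inside \<Gamma>"
  proof
    fix z assume z: "z \<in> \<Omega>"
    then have "z \<notin> outside \<Gamma>" using out[of z] winding[of z] by auto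
    then show "z \<in> inside \<Gamma>" using J(3) disj z by blast
  qed
  moreover have "\<Omega> \<noteq> {}"
  proof
    assume "\<Omega> = {}"
    then have "\<Gamma> = {}" using fr by simp
    then show False using L_pos by (auto simp: \<Gamma>_def)
  qed
  moreover have "inside \<Gamma> \<inter> frontier \<Omega> = {}" unfolding fr using J(3) by blast
  ultimately have "inside \<Gamma> \<subseteq> \<Omega>" using connected_Int_frontier[OF J(1), of \<Omega>] by blast
  then have "w \<in> outside \<Gamma>" if "w \<notin> \<Omega>" using assms J(3) that by blast
  then show ?thesis using out winding by auto
qed

text \<open>For a unit vector \<open>d\<close> the height is the coordinate orthogonal to
  \<open>d\<close>, hence constant along each line of direction \<open>d\<close>.\<close>

lemma height_derivative:
  assumes "s \<in> U"
  shows "((\<lambda>s. Im (cnj d * \<gamma> s)) has_real_derivative Im (cnj d * T s)) (at s)"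
proof -
  have "((\<lambda>s. cnj d * \<gamma> s) has_vector_derivative cnj d * T s) (at s)"
    by (intro has_vector_derivative_mult_right derivative_U assms)
  then show ?thesis
    unfolding has_real_derivative_iff_has_vector_derivative
    by (rule bounded_linear.has_vector_derivative[OF bounded_linear_Im])
qed

lemma Im_mult_cnj_commute: "Im (d * cnj z) = - Im (cnj d * z)"
  by simp

lemma divide_unit: "norm d = 1 \<Longrightarrow> z / d = cnj d * z" for z d :: complex
  using complex_div_cnj[of z d] mult.commute[of z "cnj d"] by simp

text \<open>Near \<open>s\<close> the height is strictly decreasing, so the line crosses the short
  arc only at \<open>\<gamma> s\<close>, and \<open>winding_number_jump\<close> applies. The winding
  number is 0 or 1 off the boundary; a jump by 1 therefore puts the points ahead inside the table
  and those behind outside.\<close>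

lemma local_sides:
  assumes s: "s \<in> U" and d: "norm d = 1" and pos: "Im (d * cnj (T s)) > 0"
  shows "\<forall>\<^sub>F t in at_right 0. \<gamma> s + of_real t * d \<in> \<Omega> \<and> \<gamma> s - of_real t * d \<notin> \<Omega>"
proof -
  let ?h = "\<lambda>x. Im (cnj d * \<gamma> x)" and ?h' = "\<lambda>x. Im (cnj d * T x)"
  let ?p = "boundary_path \<gamma> L" and ?w = "\<gamma> s"
  have neg: "?h' s < 0" using pos by simp
  have "isCont ?h' s" by (intro isCont_Im continuous_mult continuous_const isCont_T s)
  then have "\<forall>\<^sub>F x in nhds s. ?h' x < 0"
    unfolding isCont_def tendsto_at_iff_tendsto_nhds[of ?h' s] by (rule order_tendstoD(2)[OF _ neg])
  then obtain e1 where e1: "e1 > 0" "\<And>x. dist x s < e1 \<Longrightarrow> ?h' x < 0"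
    unfolding eventually_nhds_metric by blast
  obtain e2 where e2: "e2 > 0" "ball s e2 \<subseteq> U" using open_U s open_contains_ball by blast
  define e where "e = min e1 e2 / 2"
  have e: "e > 0" using e1 e2 by (simp add: e_def)
  have near: "x \<in> U \<and> ?h' x < 0" if "x \<in> {s - e..s + e}" for x
  proof -
    have "dist x s < e1" "dist x s < e2" using that e1 e2 by (auto simp: e_def dist_real_def)
    then show ?thesis using e1 e2 by (auto simp: dist_commute)
  qed
  have dec: "?h y < ?h x" if "s - e \<le> x" "x < y" "y \<le> s + e" for x y
  proof (rule DERIV_neg_imp_decreasing[OF that(2)])
    fix z assume z: "x \<le> z" "z \<le> y"
    then have "z \<in> {s - e..s + e}" using that by auto
    then show "\<exists>y. (?h has_real_derivative y) (at z) \<and> y < 0" using near height_derivative by blast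
  qed
  have eU: "s - e \<in> {0<..<L}" "s + e \<in> {0<..<L}" using near[of "s - e"] near[of "s + e"] e by (auto simp: U_def)
  have inj_s: "x = s" if "x \<in> {0..L}" "\<gamma> x = \<gamma> s" for x
  proof -
    have sL: "s \<in> {0<..<L}" using s by (simp add: U_def)
    show ?thesis
    proof (cases "x = L")
      case True
      then have "\<gamma> 0 = \<gamma> s" using that boundary_closed_up by simp
      then have "0 = s" using inj sL L_pos by (auto dest: inj_onD)
      then show ?thesis using sL by simp
    next
      case False
      then show ?thesis using inj sL that by (auto dest: inj_onD)
    qed
  qed
  \<comment> \<open>The rest of the boundary is compact and, by injectivity, misses
    \<open>\<gamma> s\<close>; so it keeps a distance \<open>r\<close> from it.\<close>
  define N where "N = \<gamma> ` ({0..s - e} \<union> {s + e..L})"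
  have "compact N" unfolding N_def using e eU
    by (intro compact_continuous_image continuous_on_subset[OF continuous_boundary]) auto
  moreover have "\<gamma> s \<notin> N"
  proof
    assume "\<gamma> s \<in> N"
    then obtain x where x: "x \<in> {0..s - e} \<union> {s + e..L}" "\<gamma> x = \<gamma> s" unfolding N_def by (metis imageE)
    then have "x = s" using e eU by (intro inj_s) auto
    then show False using x e by auto
  qed
  ultimately obtain r where r: "r > 0" "ball (\<gamma> s) r \<inter> N = {}"
    using open_contains_ball[of "- N"] compact_imp_closed open_Compl by (metis ComplI disjoint_eq_subset_Compl)
  have off: "\<gamma> s + of_real t * d \<notin> \<Gamma>" if t: "t \<noteq> 0" "\<bar>t\<bar> < r" for t
  proof
    assume "\<gamma> s + of_real t * d \<in> \<Gamma>"
    then obtain x where x: "x \<in> {0..L}" "\<gamma> x = \<gamma> s + of_real t * d" by (auto simp: \<Gamma>_def)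
    have "\<gamma> x \<in> ball (\<gamma> s) r" using t d by (simp add: x dist_norm norm_mult)
    then have "\<gamma> x \<notin> N" using r by blast
    then have "x \<notin> {0..s - e} \<union> {s + e..L}" unfolding N_def by blast
    then have xe: "x \<in> {s - e..s + e}" using x(1) by auto
    have "cnj d * \<gamma> x = cnj d * \<gamma> s + of_real t * (cnj d * d)" by (simp add: x algebra_simps)
    also have "cnj d * d = 1" using d by (simp add: complex_norm_square[symmetric] mult.commute)
    finally have "?h x = ?h s" by simp
    then have "x = s" using dec[of x s] dec[of s x] xe e by (cases x s rule: linorder_cases) auto
    then show False using x t d by auto
  qed
  have ev: "\<forall>\<^sub>F t in at_right 0. 0 < t \<and> t < r"
    using r(1) eventually_at_right_less[of 0] eventually_at_right_real by (auto simp: eventually_at_right_field)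
  have offm: "\<gamma> s - of_real t * d \<notin> \<Gamma>" if "0 < t" "t < r" for t
    using off[of "- t"] that by simp
  have "((\<lambda>t. winding_number ?p (?w + of_real t * d) - winding_number ?p (?w - of_real t * d)) \<longlongrightarrow> 1) (at_right 0)"
  proof (rule winding_number_jump[where u = "(s - e) / L" and v = "(s + e) / L"])
    show "valid_path ?p" by (rule valid_boundary_path)
    show "0 \<le> (s - e) / L" "(s - e) / L \<le> (s + e) / L" "(s + e) / L \<le> 1" "d \<noteq> 0"
      using eU e L_pos d by (auto simp: divide_right_mono)
    have Im: "Im ((\<gamma> x - \<gamma> s) / d) = ?h x - ?h s" for x
      unfolding divide_unit[OF d] by (simp add: algebra_simps)
    show "?p x = ?w" if "x \<in> {(s - e) / L..(s + e) / L}" "Im ((?p x - ?w) / d) = 0" for x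
    proof -
      have "L * x \<in> {s - e..s + e}" using that(1) L_pos by (auto simp: field_simps)
      moreover have "?h (L * x) = ?h s" using that(2) Im[of "L * x"] by (simp add: boundary_path_def)
      ultimately have "L * x = s" using dec[of "L * x" s] dec[of s "L * x"] e
        by (cases "L * x" s rule: linorder_cases) auto
      then show ?thesis by (simp add: boundary_path_def)
    qed
    show "0 < Im ((?p ((s - e) / L) - ?w) / d)"
      using dec[of "s - e" s] e L_pos Im[of "s - e"] by (simp add: boundary_path_def)
    show "Im ((?p ((s + e) / L) - ?w) / d) < 0"
      using dec[of s "s + e"] e L_pos Im[of "s + e"] by (simp add: boundary_path_def)
    show "?p x \<noteq> ?w" if "x \<in> {0..(s - e) / L} \<union> {(s + e) / L..1}" for x
    proof
      assume "?p x = ?w"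
      then have "\<gamma> (L * x) = \<gamma> s" by (simp add: boundary_path_def)
      moreover have "(s - e) / L \<le> 1" "0 \<le> (s + e) / L" using eU L_pos by auto
      then have "x \<in> {0..1}" using that by auto
      ultimately have "L * x = s" using inj_s scale_mem by blast
      then show False using that e L_pos by (auto simp: field_simps)
    qed
    show "\<forall>\<^sub>F t in at_right 0. ?w + of_real t * d \<notin> path_image ?p \<and> ?w - of_real t * d \<notin> path_image ?p"
      using ev by eventually_elim (use off offm in \<open>auto simp: path_image_boundary\<close>)
  qed
  \<comment> \<open>The differences are -1, 0 or 1, and among these only 1 has distance less than 1
    from the limit.\<close>
  then have "\<forall>\<^sub>F t in at_right 0. dist (winding_number ?p (?w + of_real t * d) - winding_number ?p (?w - of_real t * d)) 1 < 1"
    by (rule tendstoD) simp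
  with ev show ?thesis
  proof eventually_elim
    fix t assume t: "0 < t \<and> t < r" 
      and *: "dist (winding_number ?p (?w + of_real t * d) - winding_number ?p (?w - of_real t * d)) 1 < 1"
    have "winding_number ?p (?w + of_real t * d) = (if ?w + of_real t * d \<in> \<Omega> then 1 else 0)"
      by (rule winding_number_off_boundary) (use off t in auto)
    moreover have "winding_number ?p (?w - of_real t * d) = (if ?w - of_real t * d \<in> \<Omega> then 1 else 0)"
      by (rule winding_number_off_boundary) (use offm t in auto)
    ultimately show "\<gamma> s + of_real t * d \<in> \<Omega> \<and> \<gamma> s - of_real t * d \<notin> \<Omega>"
      using * by (auto split: if_splits simp: dist_norm)
  qed
qed

section \<open>Chords in a fixed direction\<close>

definition hit :: "real \<Rightarrow> complex \<Rightarrow> real" where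
  "hit s d = Inf {t. t > 0 \<and> \<gamma> s + of_real t * d \<in> \<Gamma>}"

definition foot :: "complex \<Rightarrow> real" where
  "foot p = (THE s'. s' \<in> {0..<L} \<and> \<gamma> s' = p)"

text \<open>The direction is a complex number and not an angle against the tangent, so that it stays
  fixed while the footpoint runs over all crossings of a family of parallel lines.\<close>

definition nxt :: "real \<Rightarrow> complex \<Rightarrow> real" where
  "nxt s d = foot (\<gamma> s + of_real (hit s d) * d)"

lemma billiard_map_eq:
  "billiard_map \<gamma> L (s, \<theta>) =
     (nxt s (T s * cis \<theta>), Arg (T (nxt s (T s * cis \<theta>)) * cnj (T s * cis \<theta>)))"
  by (simp add: billiard_map_def Let_def nxt_def foot_def hit_def \<Gamma>_def)

lemma foot_eq: "s \<in> {0..<L} \<Longrightarrow> foot (\<gamma> s) = s"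
  unfolding foot_def by (rule the_equality) (use inj in \<open>auto dest: inj_onD\<close>)

text \<open>The condition is imposed on all boundary points of the line, not just on the two ends of
  a chord. So it depends on the height alone, and wherever the ray first hits, it hits a smooth
  point transversally.\<close>

definition regular :: "complex \<Rightarrow> real \<Rightarrow> bool" where
  "regular d p \<longleftrightarrow> (\<forall>s\<in>{0..<L}. Im (cnj d * \<gamma> s) = p \<longrightarrow> s \<in> U \<and> Im (cnj d * T s) \<noteq> 0)"

lemma regular_minus: "regular (- d) (- p) \<longleftrightarrow> regular d p"
proof -
  have "Im (cnj (- d) * z) = - Im (cnj d * z)" for z by simp
  then show ?thesis unfolding regular_def by (metis neg_equal_iff_equal neg_equal_0_iff_equal)
qed

text \<open>Behind an entry the ray runs inside the table, which is bounded, so it has a first hit.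
  The open segment up to it lies in the table: therefore the hit is an exit, and the reversed ray
  meets no boundary point before it is back at the start.\<close>

lemma nxt_regular:
  assumes s: "s \<in> U" and d: "norm d = 1" and reg: "regular d (Im (cnj d * \<gamma> s))"
    and entry: "Im (cnj d * T s) < 0"
  shows "nxt s d \<in> U" "Im (cnj d * \<gamma> (nxt s d)) = Im (cnj d * \<gamma> s)" "Im (cnj d * T (nxt s d)) > 0"
    "nxt s d \<noteq> s" "nxt (nxt s d) (- d) = s"
proof -
  define E where "E = {t. t > 0 \<and> \<gamma> s + of_real t * d \<in> \<Gamma>}"
  define t where "t = Inf E"
  have sL: "s \<in> {0..<L}" using s by (auto simp: U_def)
  have fr: "frontier \<Omega> = \<Gamma>" using frontier_table by (simp add: \<Gamma>_def)
  have disj: "\<Omega> \<inter> \<Gamma> = {}" using open_table frontier_disjoint_eq fr by blast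
  have pos: "Im (d * cnj (T s)) > 0" using entry unfolding Im_mult_cnj_commute by simp
  obtain e where e: "e > 0" "\<And>x. 0 < x \<Longrightarrow> x < e \<Longrightarrow> \<gamma> s + of_real x * d \<in> \<Omega>"
    using local_sides[OF s d pos] unfolding eventually_at_right_field by auto
  have conn: "\<gamma> s + of_real x * d \<in> \<Omega>" if "0 < x" "\<And>y. 0 < y \<Longrightarrow> y \<le> x \<Longrightarrow> y \<notin> E" for x
  proof -
    have "connected ((\<lambda>y. \<gamma> s + of_real y * d) ` {0<..x})"
      by (intro connected_continuous_image continuous_intros) (simp add: is_interval_connected_1[symmetric] is_interval_oc)
    moreover have "(\<lambda>y. \<gamma> s + of_real y * d) ` {0<..x} \<inter> frontier \<Omega> = {}"
      using that(2) by (auto simp: fr E_def)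
    moreover have "\<gamma> s + of_real (min x (e/2)) * d \<in> (\<lambda>y. \<gamma> s + of_real y * d) ` {0<..x} \<inter> \<Omega>"
      using that(1) e by auto
    ultimately have "(\<lambda>y. \<gamma> s + of_real y * d) ` {0<..x} \<subseteq> \<Omega>"
      using connected_Int_frontier by blast
    then show ?thesis using that(1) by (meson greaterThanAtMost_iff image_subset_iff order_refl)
  qed
  have Ene: "E \<noteq> {}"
  proof
    assume "E = {}"
    then have all: "\<gamma> s + of_real x * d \<in> \<Omega>" if "0 < x" for x using conn that by auto
    obtain B where B: "\<And>z. z \<in> \<Omega> \<Longrightarrow> norm z \<le> B" "B > 0" using bounded_table bounded_pos by metis
    define x where "x = B + norm (\<gamma> s) + 1"
    have x0: "x > 0" using B by (simp add: x_def add_pos_nonneg)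
    have "x = norm (of_real x * d)" using x0 d by (simp add: norm_mult)
    also have "\<dots> \<le> norm (\<gamma> s + of_real x * d) + norm (\<gamma> s)"
      by (metis add_diff_cancel_left' norm_triangle_ineq4)
    also have "\<dots> \<le> B + norm (\<gamma> s)" using B(1)[OF all[OF x0]] by simp
    finally show False by (simp add: x_def)
  qed
  \<comment> \<open>The initial stretch inside the table keeps the hitting times away from 0. This
    makes the set of hitting times closed although \<open>t > 0\<close> is an open condition, and
    its infimum is attained.\<close>
  have Ee: "E = {e..} \<inter> (\<lambda>x. \<gamma> s + of_real x * d) -` \<Gamma>"
    using e disj by (force simp: E_def not_less[symmetric])
  have "closed E" unfolding Ee
    by (intro closed_Int closed_vimage compact_imp_closed[OF compact_boundary] continuous_intros closed_atLeast)
  moreover have "bdd_below E" by (auto simp: E_def intro: less_imp_le bdd_belowI[of _ 0])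
  ultimately have tE: "t \<in> E" unfolding t_def using Ene closed_contains_Inf by blast
  then have t0: "t > 0" and tG: "\<gamma> s + of_real t * d \<in> \<Gamma>" by (auto simp: E_def)
  have before: "x \<notin> E" if "x < t" for x
    using that cInf_lower[OF _ \<open>bdd_below E\<close>, of x] by (auto simp: t_def)
  have inside: "\<gamma> s + of_real x * d \<in> \<Omega>" if "0 < x" "x < t" for x
    using conn[of x] before that by (meson order_le_less_trans)
  have hit: "hit s d = t" by (simp add: hit_def t_def E_def)
  obtain s' where s': "s' \<in> {0..<L}" "\<gamma> s' = \<gamma> s + of_real t * d"
    using tG unfolding boundary_half_open by auto
  have nx: "nxt s d = s'" unfolding nxt_def hit s'(2)[symmetric] by (rule foot_eq[OF s'(1)])
  have dd: "cnj d * d = 1" using d by (simp add: complex_norm_square[symmetric] mult.commute)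
  have "cnj d * \<gamma> s' = cnj d * \<gamma> s + of_real t * (cnj d * d)" by (simp add: s' algebra_simps)
  then have same: "Im (cnj d * \<gamma> s') = Im (cnj d * \<gamma> s)" unfolding dd by simp
  then have s'U: "s' \<in> U" and nz: "Im (cnj d * T s') \<noteq> 0" using reg s'(1) by (auto simp: regular_def)
  \<comment> \<open>If the line entered the table at \<open>s'\<close>, points just before
    \<open>s'\<close> would be outside; but they belong to the segment inside.\<close>
  have exit: "Im (cnj d * T s') > 0"
  proof (rule ccontr)
    assume "\<not> ?thesis"
    then have "Im (d * cnj (T s')) > 0" using nz unfolding Im_mult_cnj_commute by simp
    then obtain e' where e': "e' > 0" "\<And>x. 0 < x \<Longrightarrow> x < e' \<Longrightarrow> \<gamma> s' - of_real x * d \<notin> \<Omega>"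
      using local_sides[OF s'U d] unfolding eventually_at_right_field by auto
    define x where "x = min e' t / 2"
    have x: "0 < x" "x < e'" "x < t" using e' t0 by (auto simp: x_def)
    have "\<gamma> s' - of_real x * d = \<gamma> s + of_real (t - x) * d" by (simp add: s' algebra_simps)
    then show False using e'(2)[OF x(1,2)] inside[of "t - x"] x by simp
  qed
  show "nxt s d \<in> U" "Im (cnj d * \<gamma> (nxt s d)) = Im (cnj d * \<gamma> s)" "Im (cnj d * T (nxt s d)) > 0"
    using nx s'U same exit by auto
  show "nxt s d \<noteq> s" using nx s'(2) t0 d by auto
  have line: "\<gamma> s' + of_real x * - d = \<gamma> s + of_real (t - x) * d" for x by (simp add: s' algebra_simps)
  \<comment> \<open>An earlier hit on the way back would be a boundary point in the open segment,
    which lies in the open table.\<close>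
  have "hit s' (- d) = t"
    unfolding hit_def
  proof (rule cInf_eq_minimum)
    have "\<gamma> s \<in> \<Gamma>" unfolding boundary_half_open using sL by blast
    then show "t \<in> {x. 0 < x \<and> \<gamma> s' + of_real x * - d \<in> \<Gamma>}" unfolding line using t0 by simp
    fix x assume "x \<in> {x. 0 < x \<and> \<gamma> s' + of_real x * - d \<in> \<Gamma>}"
    then have x: "0 < x" "\<gamma> s + of_real (t - x) * d \<in> \<Gamma>" unfolding line by auto
    show "t \<le> x"
    proof (rule ccontr)
      assume "\<not> t \<le> x"
      then have "\<gamma> s + of_real (t - x) * d \<in> \<Omega>" using x by (intro inside) auto
      then show False using x disj by blast
    qed
  qed
  then show "nxt (nxt s d) (- d) = s"
    unfolding nx nxt_def[of s'] line using foot_eq[OF sL] by (simp add: line)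
qed

end

section \<open>Measurability of the billiard map\<close>

lemma cis_meas[measurable]: "cis \<in> borel_measurable borel"
  by (intro borel_measurable_continuous_onI continuous_intros)

lemma cnj_meas[measurable]: "cnj \<in> borel_measurable borel"
  by (intro borel_measurable_continuous_onI continuous_intros)

lemma Arg_meas[measurable]: "Arg \<in> borel_measurable borel"
proof -
  have "Arg = (\<lambda>z. if z = 0 then 0 else Im (Ln z))" by (auto simp: Arg_eq_Im_Ln Arg_zero)
  also have "\<dots> \<in> borel_measurable borel" by measurable
  finally show ?thesis .
qed

text \<open>Hitting a closed set during a compact time interval is a countable condition: the
  distance to the set is continuous in time, so it has a zero iff it becomes arbitrarily small at
  rational times of the interval.\<close>

lemma Inf_ray_hit_meas:
  fixes P D :: "'a \<Rightarrow> complex"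
  assumes [measurable]: "P \<in> borel_measurable M" "D \<in> borel_measurable M" and G: "closed G" "G \<noteq> {}"
  shows "(\<lambda>z. Inf {t. t > 0 \<and> P z + of_real t * D z \<in> G}) \<in> borel_measurable M"
proof -
  define R where "R z t = infdist (P z + of_real t * D z) G" for z t
  have [measurable]: "(\<lambda>z. infdist z G) \<in> borel_measurable borel"
    by (intro borel_measurable_continuous_onI continuous_intros)
  have [measurable]: "(\<lambda>z. R z t) \<in> borel_measurable M" for t unfolding R_def by measurable
  have R_cont: "continuous_on A (R z)" for A z unfolding R_def by (intro continuous_intros)
  have R_iff: "P z + of_real t * D z \<in> G \<longleftrightarrow> R z t = 0" for z t
    unfolding R_def using G by (simp add: in_closed_iff_infdist_zero)
  have R_nonneg: "0 \<le> R z t" for z t unfolding R_def by (rule infdist_nonneg)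
  define H where "H a b = {z \<in> space M. \<exists>t\<in>{a..b}. P z + of_real t * D z \<in> G}" for a b
  have H: "H a b \<in> sets M" if ab: "a < b" for a b
  proof -
    have "H a b = {z \<in> space M. \<forall>n. \<exists>q\<in>{q. of_rat q \<in> {a..b}}. R z (of_rat q) < 1 / real (Suc n)}"
    proof (intro set_eqI iffI)
      fix z assume "z \<in> H a b"
      then obtain t where z: "z \<in> space M" and t: "t \<in> {a..b}" "R z t = 0" by (auto simp: H_def R_iff)
      have "\<exists>q\<in>{q. of_rat q \<in> {a..b}}. R z (of_rat q) < 1 / real (Suc n)" for n
      proof -
        have "\<exists>e>0. \<forall>x. dist x t < e \<longrightarrow> dist (R z x) (R z t) < 1 / real (Suc n)"
          using R_cont[of UNIV z] unfolding continuous_on_iff by (metis UNIV_I zero_less_divide_1_iff of_nat_0_less_iff zero_less_Suc)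
        then obtain e where e: "e > 0" "\<And>x. dist x t < e \<Longrightarrow> R z x < 1 / real (Suc n)"
          using t(2) R_nonneg by (auto simp: dist_real_def)
        have "max a (t - e) < min b (t + e)" using t ab e(1) by auto
        then obtain q where q: "max a (t - e) < of_rat q" "of_rat q < min b (t + e)" using of_rat_dense by blast
        then have "dist (of_rat q) t < e" by (auto simp: dist_real_def)
        then show ?thesis using e(2) q by (intro bexI[of _ q]) auto
      qed
      then show "z \<in> {z \<in> space M. \<forall>n. \<exists>q\<in>{q. of_rat q \<in> {a..b}}. R z (of_rat q) < 1 / real (Suc n)}" using z by blast
    next
      fix z assume "z \<in> {z \<in> space M. \<forall>n. \<exists>q\<in>{q. of_rat q \<in> {a..b}}. R z (of_rat q) < 1 / real (Suc n)}"
      then have z: "z \<in> space M" and *: "\<And>n. \<exists>q\<in>{q. of_rat q \<in> {a..b}}. R z (of_rat q) < 1 / real (Suc n)" by auto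
      obtain t where t: "t \<in> {a..b}" "\<And>x. x \<in> {a..b} \<Longrightarrow> R z t \<le> R z x"
        using continuous_attains_inf[OF compact_Icc _ R_cont, of a b z] ab by auto
      have "R z t = 0"
      proof (rule ccontr)
        assume "R z t \<noteq> 0"
        then have "0 < R z t" using R_nonneg[of z t] by simp
        then obtain n where "1 / real (Suc n) < R z t" using reals_Archimedean by (auto simp: inverse_eq_divide)
        moreover obtain q where "of_rat q \<in> {a..b}" "R z (of_rat q) < 1 / real (Suc n)" using *[of n] by blast
        ultimately show False using t(2)[of "of_rat q"] by linarith
      qed
      then show "z \<in> H a b" using z t by (auto simp: H_def R_iff)
    qed
    also have "\<dots> \<in> sets M" by measurable
    finally show ?thesis .
  qed
  define E where "E z = {t. t > 0 \<and> P z + of_real t * D z \<in> G}" for z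
  define a where "a n = 1 / real (Suc n)" for n
  have a0: "a n > 0" for n by (simp add: a_def)
  \<comment> \<open>The times strictly between 0 and \<open>c\<close> are exhausted by compact
    intervals with margin \<open>a n\<close> at both ends.\<close>
  have below: "{z \<in> space M. \<exists>t\<in>E z. t < c} = (\<Union>n\<in>{n. a n < c - a n}. H (a n) (c - a n))" for c
  proof (intro set_eqI iffI)
    fix z assume "z \<in> {z \<in> space M. \<exists>t\<in>E z. t < c}"
    then obtain t where z: "z \<in> space M" and t: "0 < t" "t < c" "P z + of_real t * D z \<in> G" by (auto simp: E_def)
    then have "0 < min (t / 2) (c - t)" by simp
    then obtain n where n: "a n < min (t / 2) (c - t)"
      using reals_Archimedean[OF \<open>0 < min (t / 2) (c - t)\<close>] unfolding a_def inverse_eq_divide by blast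
    then have "n \<in> {n. a n < c - a n}" "t \<in> {a n..c - a n}" using t by auto
    then show "z \<in> (\<Union>n\<in>{n. a n < c - a n}. H (a n) (c - a n))" using z t(3) unfolding H_def by blast
  next
    fix z assume "z \<in> (\<Union>n\<in>{n. a n < c - a n}. H (a n) (c - a n))"
    then obtain n t where t: "z \<in> space M" "t \<in> {a n..c - a n}" "P z + of_real t * D z \<in> G" by (auto simp: H_def)
    then have "t \<in> E z" "t < c" using a0[of n] by (auto simp: E_def)
    then show "z \<in> {z \<in> space M. \<exists>t\<in>E z. t < c}" using t by blast
  qed
  have below_meas[measurable]: "{z \<in> space M. \<exists>t\<in>E z. t < c} \<in> sets M" for c
    unfolding below by (intro sets.countable_UN') (auto intro: H)
  have "{z \<in> space M. E z \<noteq> {}} = (\<Union>n. {z \<in> space M. \<exists>t\<in>E z. t < real n})"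
    using reals_Archimedean2 by fastforce
  also have "\<dots> \<in> sets M" using below_meas by blast
  finally have [measurable]: "{z \<in> space M. E z \<noteq> {}} \<in> sets M" .
  have "{z \<in> space M. Inf (E z) < c} \<in> sets M" for c
  proof -
    have bdd: "bdd_below (E z)" for z by (auto simp: E_def intro: less_imp_le bdd_belowI[of _ 0])
    \<comment> \<open>Where the ray never hits, the infimum is the constant \<open>Inf {}\<close>,
      and the whole set of such points is included or not.\<close>
    have "{z \<in> space M. Inf (E z) < c} = {z \<in> space M. \<exists>t\<in>E z. t < c} \<union>
       (if Inf {} < c then space M - {z \<in> space M. E z \<noteq> {}} else {})"
    proof (intro set_eqI)
      fix z
      show "z \<in> {z \<in> space M. Inf (E z) < c} \<longleftrightarrow> z \<in> {z \<in> space M. \<exists>t\<in>E z. t < c} \<union>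
         (if Inf {} < c then space M - {z \<in> space M. E z \<noteq> {}} else {})"
        using cInf_less_iff[OF _ bdd, of z c] by (cases "E z = {}") auto
    qed
    also have "\<dots> \<in> sets M" by auto
    finally show ?thesis .
  qed
  then show ?thesis unfolding E_def by (rule borel_measurableI_less)
qed

text \<open>Rotation or reflection of the circle makes the reference direction \<open>c\<close>
  disappear. Directions on the wrong side have a nonpositive imaginary part, which
  \<open>ennreal\<close> truncates to 0, so that only the half circle of admissible angles
  remains.\<close>

lemma nn_integral_angle:
  fixes G :: "real \<Rightarrow> ennreal"
  assumes [measurable]: "G \<in> borel_measurable borel" and c: "norm c = 1"
  shows "(\<integral>\<^sup>+w. G (Arg (c * cis w)) * ennreal (Im (c * cis w)) * indicator {0..<2*pi} w \<partial>lborel) =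
      (\<integral>\<^sup>+\<theta>. G \<theta> * ennreal (sin \<theta>) * indicator {0..pi} \<theta> \<partial>lborel)"
    and "(\<integral>\<^sup>+w. G (Arg (c * cnj (cis w))) * ennreal (Im (c * cnj (cis w))) * indicator {0..<2*pi} w \<partial>lborel) =
      (\<integral>\<^sup>+\<theta>. G \<theta> * ennreal (sin \<theta>) * indicator {0..pi} \<theta> \<partial>lborel)"
proof -
  define H where "H u = G (Arg u) * ennreal (Im u)" for u
  have [measurable]: "H \<in> borel_measurable borel" unfolding H_def by measurable
  have rot: "(\<integral>\<^sup>+w. H (c * cis w) * indicator {0..<2*pi} w \<partial>lborel) = (\<integral>\<^sup>+\<theta>. G \<theta> * ennreal (sin \<theta>) * indicator {0..pi} \<theta> \<partial>lborel)"
    unfolding nn_integral_circle_rotate[OF \<open>H \<in> borel_measurable borel\<close> c]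
  proof (intro nn_integral_cong)
    fix w :: real
    show "H (cis w) * indicator {0..<2*pi} w = G w * ennreal (sin w) * indicator {0..pi} w"
    proof (cases "w \<in> {0..pi}")
      case True
      then have w: "0 \<le> w" "w \<le> pi" by auto
      have "- pi < 0" "pi < 2 * pi" by simp_all
      then have "- pi < w" "w < 2 * pi" using w by linarith+
      then have "Arg (cis w) = w" using w(2) by (intro Arg_cis) simp
      then show ?thesis using True \<open>w < 2 * pi\<close> by (simp add: H_def)
    next
      case False
      then have "w \<in> {0..<2*pi} \<Longrightarrow> ennreal (sin w) = 0" using sin_le_zero[of w] by (intro ennreal_neg) auto
      then show ?thesis using False by (auto simp: H_def split: split_indicator)
    qed
  qed
  then show "(\<integral>\<^sup>+w. G (Arg (c * cis w)) * ennreal (Im (c * cis w)) * indicator {0..<2*pi} w \<partial>lborel) =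
      (\<integral>\<^sup>+\<theta>. G \<theta> * ennreal (sin \<theta>) * indicator {0..pi} \<theta> \<partial>lborel)" by (simp only: H_def)
  have [measurable]: "(\<lambda>u. H (c * u)) \<in> borel_measurable borel" by measurable
  have "(\<integral>\<^sup>+w. H (c * cnj (cis w)) * indicator {0..<2*pi} w \<partial>lborel) = (\<integral>\<^sup>+w. H (c * cis w) * indicator {0..<2*pi} w \<partial>lborel)"
    by (rule nn_integral_circle_cnj) measurable
  then show "(\<integral>\<^sup>+w. G (Arg (c * cnj (cis w))) * ennreal (Im (c * cnj (cis w))) * indicator {0..<2*pi} w \<partial>lborel) =
      (\<integral>\<^sup>+\<theta>. G \<theta> * ennreal (sin \<theta>) * indicator {0..pi} \<theta> \<partial>lborel)" unfolding rot by (simp only: H_def)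
qed

context billiard_table
begin

lemma foot_meas[measurable]: "foot \<in> borel_measurable borel"
proof (rule borel_measurableI_le)
  fix c :: real
  \<comment> \<open>Off the boundary the predicate under \<open>THE\<close> is unsatisfiable, so
    \<open>foot\<close> takes one and the same value there.\<close>
  define c0 where "c0 = (THE s'::real. False)"
  have out: "foot p = c0" if "p \<notin> \<Gamma>" for p
  proof -
    have "(\<lambda>s'. s' \<in> {0..<L} \<and> \<gamma> s' = p) = (\<lambda>_. False)" using that by (auto simp: boundary_half_open)
    then show ?thesis by (simp add: foot_def c0_def)
  qed
  have "\<gamma> ` ({0..<L} \<inter> {..c}) \<in> sets borel"
  proof (cases "c < L")
    case True
    then have "{0..<L} \<inter> {..c} = {0..c}" by auto
    moreover have "compact (\<gamma> ` {0..c})"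
      using True by (intro compact_continuous_image continuous_on_subset[OF continuous_boundary]) auto
    ultimately show ?thesis by (simp add: borel_compact)
  next
    case False
    then have "{0..<L} \<inter> {..c} = {0..<L}" by auto
    then show ?thesis using compact_boundary by (simp add: boundary_half_open borel_compact)
  qed
  moreover have "- \<Gamma> \<in> sets borel" using compact_imp_closed[OF compact_boundary] by (simp add: borel_open open_Compl)
  moreover have "{p \<in> space borel. foot p \<le> c} = \<gamma> ` ({0..<L} \<inter> {..c}) \<union> (if c0 \<le> c then - \<Gamma> else {})"
  proof (intro set_eqI)
    fix p
    show "p \<in> {p \<in> space borel. foot p \<le> c} \<longleftrightarrow> p \<in> \<gamma> ` ({0..<L} \<inter> {..c}) \<union> (if c0 \<le> c then - \<Gamma> else {})"
    proof (cases "p \<in> \<Gamma>")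
      case True
      then obtain s where s: "s \<in> {0..<L}" "p = \<gamma> s" by (auto simp: boundary_half_open)
      have "p \<in> \<gamma> ` ({0..<L} \<inter> {..c}) \<longleftrightarrow> s \<le> c"
        using s inj by (auto dest: inj_onD)
      then show ?thesis using True s foot_eq by simp
    next
      case False
      then have "p \<notin> \<gamma> ` ({0..<L} \<inter> {..c})" by (auto simp: boundary_half_open)
      then show ?thesis using False out by simp
    qed
  qed
  ultimately show "{p \<in> space borel. foot p \<le> c} \<in> sets borel" by auto
qed

lemma nxt_meas[measurable (raw)]:
  assumes [measurable]: "S \<in> borel_measurable M" "D \<in> borel_measurable M"
  shows "(\<lambda>z. nxt (S z) (D z)) \<in> borel_measurable M"
proof -
  have "closed \<Gamma>" "\<Gamma> \<noteq> {}" using compact_boundary compact_imp_closed L_pos by (auto simp: \<Gamma>_def)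
  then have [measurable]: "(\<lambda>z. hit (S z) (D z)) \<in> borel_measurable M"
    unfolding hit_def by (intro Inf_ray_hit_meas) measurable
  show ?thesis unfolding nxt_def by measurable
qed

lemma billiard_map_meas[measurable]: "billiard_map \<gamma> L \<in> borel_measurable borel"
proof -
  have "billiard_map \<gamma> L = (\<lambda>z. (nxt (fst z) (T (fst z) * cis (snd z)),
      Arg (T (nxt (fst z) (T (fst z) * cis (snd z))) * cnj (T (fst z) * cis (snd z)))))"
    using billiard_map_eq by auto
  also have "\<dots> \<in> borel_measurable borel" 
    unfolding borel_prod[symmetric] by measurable
  finally show ?thesis .
qed

end

section \<open>Invariance of the Liouville measure\<close>

context billiard_table
begin

text \<open>The Liouville measure as a Borel measure on the whole plane. The billiard map is Borel on the whole
  plane, junk values included, so no orbit has to be cut off where it leaves the phase space.\<close>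

definition \<nu> :: "(real \<times> real) measure" where
  "\<nu> = density lborel (\<lambda>z. ennreal (sin (snd z)) * indicator (phase_space L) z)"

lemma sets_\<nu>[simp, measurable_cong]: "sets \<nu> = sets borel"
  by (simp add: \<nu>_def)

lemma space_\<nu>[simp]: "space \<nu> = UNIV"
  by (simp add: \<nu>_def)

lemma phase_space_meas[measurable]: "phase_space L \<in> sets borel"
  unfolding phase_space_def by (intro borel_closed closed_Times) auto

lemma nn_integral_\<nu>:
  assumes [measurable]: "F \<in> borel_measurable borel"
  shows "(\<integral>\<^sup>+z. F z \<partial>\<nu>) = (\<integral>\<^sup>+s. (\<integral>\<^sup>+\<theta>. F (s, \<theta>) * ennreal (sin \<theta>) * indicator {0..pi} \<theta> \<partial>lborel) * indicator {0..L} s \<partial>lborel)"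
proof -
  have [measurable]: "F \<in> borel_measurable (borel \<Otimes>\<^sub>M borel)" unfolding borel_prod by measurable
  have [measurable]: "phase_space L \<in> sets (borel \<Otimes>\<^sub>M borel)" unfolding borel_prod by measurable
  have "(\<integral>\<^sup>+z. F z \<partial>\<nu>) = (\<integral>\<^sup>+z. ennreal (sin (snd z)) * indicator (phase_space L) z * F z \<partial>lborel)"
  proof -
    have "(\<lambda>z. ennreal (sin (snd z)) * indicator (phase_space L) z) \<in> borel_measurable (borel \<Otimes>\<^sub>M borel)"
      by measurable
    then show ?thesis
      unfolding \<nu>_def borel_prod by (intro nn_integral_density) (simp_all add: assms)
  qed
  also have "\<dots> = (\<integral>\<^sup>+s. (\<integral>\<^sup>+\<theta>. ennreal (sin \<theta>) * indicator (phase_space L) (s, \<theta>) * F (s, \<theta>) \<partial>lborel) \<partial>lborel)"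
    unfolding lborel_prod[symmetric] by (subst lborel.nn_integral_fst[symmetric]) (simp_all, measurable)
  also have "\<dots> = (\<integral>\<^sup>+s. (\<integral>\<^sup>+\<theta>. F (s, \<theta>) * ennreal (sin \<theta>) * indicator {0..pi} \<theta> \<partial>lborel) * indicator {0..L} s \<partial>lborel)"
    by (intro nn_integral_cong) (auto simp: phase_space_def mult.commute split: split_indicator intro!: nn_integral_cong)
  finally show ?thesis .
qed

lemma AE_U: "AE s in lborel. (indicator {0..L} s :: ennreal) = indicator U s"
proof -
  have "AE s in lborel. s \<notin> K"
    by (rule AE_not_in) (simp add: finite_imp_null_set_lborel K)
  then show ?thesis
    by eventually_elim (use K in \<open>auto simp: U_def indicator_def order.order_iff_strict\<close>)
qed

text \<open>Two readings of the same measure. In the first, \<open>cis w\<close> is the direction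
  leaving \<open>s\<close>; in the second, it is the direction arriving at \<open>s\<close>, and
  \<open>Arg (T s * cnj (cis w))\<close> is the angle after reflection. In both, the sine becomes
  the slope of the height up to sign. Exchanging the integrals then fixes the direction.\<close>

lemma nn_integral_\<nu>_lines:
  assumes [measurable]: "F \<in> borel_measurable borel"
  shows "(\<integral>\<^sup>+z. F z \<partial>\<nu>) = (\<integral>\<^sup>+w. (\<integral>\<^sup>+s. F (s, Arg (cis w * cnj (T s))) * ennreal (- Im (cnj (cis w) * T s)) * indicator U s \<partial>lborel)
      * indicator {0..<2*pi} w \<partial>lborel)" (is "_ = ?A")
    and "(\<integral>\<^sup>+z. F z \<partial>\<nu>) = (\<integral>\<^sup>+w. (\<integral>\<^sup>+s. F (s, Arg (T s * cnj (cis w))) * ennreal (Im (cnj (cis w) * T s)) * indicator U s \<partial>lborel)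
      * indicator {0..<2*pi} w \<partial>lborel)" (is "_ = ?B")
proof -
  have [measurable]: "F \<in> borel_measurable (borel \<Otimes>\<^sub>M borel)" unfolding borel_prod by measurable
  have [measurable]: "U \<in> sets borel" using open_U by simp
  have start: "(\<integral>\<^sup>+z. F z \<partial>\<nu>) = (\<integral>\<^sup>+s. (\<integral>\<^sup>+\<theta>. F (s, \<theta>) * ennreal (sin \<theta>) * indicator {0..pi} \<theta> \<partial>lborel) * indicator U s \<partial>lborel)"
    unfolding nn_integral_\<nu>[OF assms] by (rule nn_integral_cong_AE) (use AE_U in eventually_elim, simp)
  have swap: "(\<integral>\<^sup>+s. (\<integral>\<^sup>+w. Q s w * indicator {0..<2*pi} w \<partial>lborel) * indicator U s \<partial>lborel)
      = (\<integral>\<^sup>+w. (\<integral>\<^sup>+s. Q s w * indicator U s \<partial>lborel) * indicator {0..<2*pi} w \<partial>lborel)"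
    if [measurable]: "(\<lambda>(s, w). Q s w) \<in> borel_measurable (borel \<Otimes>\<^sub>M borel)" for Q :: "real \<Rightarrow> real \<Rightarrow> ennreal"
  proof -
    have "(\<integral>\<^sup>+s. (\<integral>\<^sup>+w. Q s w * indicator {0..<2*pi} w \<partial>lborel) * indicator U s \<partial>lborel)
      = (\<integral>\<^sup>+s. (\<integral>\<^sup>+w. Q s w * indicator {0..<2*pi} w * indicator U s \<partial>lborel) \<partial>lborel)"
      by (intro nn_integral_cong nn_integral_multc[symmetric]) measurable
    also have "\<dots> = (\<integral>\<^sup>+w. (\<integral>\<^sup>+s. Q s w * indicator {0..<2*pi} w * indicator U s \<partial>lborel) \<partial>lborel)"
      by (rule lborel_pair.Fubini') measurable
    also have "\<dots> = (\<integral>\<^sup>+w. (\<integral>\<^sup>+s. Q s w * indicator U s * indicator {0..<2*pi} w \<partial>lborel) \<partial>lborel)"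
      by (simp add: mult_ac)
    also have "\<dots> = (\<integral>\<^sup>+w. (\<integral>\<^sup>+s. Q s w * indicator U s \<partial>lborel) * indicator {0..<2*pi} w \<partial>lborel)"
      by (intro nn_integral_cong nn_integral_multc) measurable
    finally show ?thesis .
  qed
  have "(\<integral>\<^sup>+z. F z \<partial>\<nu>) = (\<integral>\<^sup>+s. (\<integral>\<^sup>+w. F (s, Arg (cnj (T s) * cis w)) * ennreal (Im (cnj (T s) * cis w)) * indicator {0..<2*pi} w \<partial>lborel) * indicator U s \<partial>lborel)"
    unfolding start
  proof (intro nn_integral_cong)
    fix s
    have "(\<lambda>\<theta>. F (s, \<theta>)) \<in> borel_measurable borel" by measurable
    then show "(\<integral>\<^sup>+\<theta>. F (s, \<theta>) * ennreal (sin \<theta>) * indicator {0..pi} \<theta> \<partial>lborel) * indicator U s =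
      (\<integral>\<^sup>+w. F (s, Arg (cnj (T s) * cis w)) * ennreal (Im (cnj (T s) * cis w)) * indicator {0..<2*pi} w \<partial>lborel) * indicator U s"
      using nn_integral_angle(1)[of "\<lambda>\<theta>. F (s, \<theta>)" "cnj (T s)"] norm_T[of s]
      by (cases "s \<in> U") (simp_all del: times_complex.sel)
  qed
  also have "\<dots> = (\<integral>\<^sup>+w. (\<integral>\<^sup>+s. F (s, Arg (cnj (T s) * cis w)) * ennreal (Im (cnj (T s) * cis w)) * indicator U s \<partial>lborel) * indicator {0..<2*pi} w \<partial>lborel)"
    by (rule swap) measurable
  also have "\<dots> = ?A"
    by (intro nn_integral_cong) (simp add: mult.commute)
  finally show "(\<integral>\<^sup>+z. F z \<partial>\<nu>) = ?A" .
  have "(\<integral>\<^sup>+z. F z \<partial>\<nu>) = (\<integral>\<^sup>+s. (\<integral>\<^sup>+w. F (s, Arg (T s * cnj (cis w))) * ennreal (Im (T s * cnj (cis w))) * indicator {0..<2*pi} w \<partial>lborel) * indicator U s \<partial>lborel)"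
    unfolding start
  proof (intro nn_integral_cong)
    fix s
    have "(\<lambda>\<theta>. F (s, \<theta>)) \<in> borel_measurable borel" by measurable
    then show "(\<integral>\<^sup>+\<theta>. F (s, \<theta>) * ennreal (sin \<theta>) * indicator {0..pi} \<theta> \<partial>lborel) * indicator U s =
      (\<integral>\<^sup>+w. F (s, Arg (T s * cnj (cis w))) * ennreal (Im (T s * cnj (cis w))) * indicator {0..<2*pi} w \<partial>lborel) * indicator U s"
      using nn_integral_angle(2)[of "\<lambda>\<theta>. F (s, \<theta>)" "T s"] norm_T[of s]
      by (cases "s \<in> U") (simp_all del: times_complex.sel)
  qed
  also have "\<dots> = (\<integral>\<^sup>+w. (\<integral>\<^sup>+s. F (s, Arg (T s * cnj (cis w))) * ennreal (Im (T s * cnj (cis w))) * indicator U s \<partial>lborel) * indicator {0..<2*pi} w \<partial>lborel)"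
    by (rule swap) measurable
  also have "\<dots> = ?B"
    by (intro nn_integral_cong) (simp add: mult.commute)
  finally show "(\<integral>\<^sup>+z. F z \<partial>\<nu>) = ?B" .
qed

text \<open>\<open>Im (cnj d * T s)\<close> is negative iff \<open>d\<close> points to the left of the boundary, that is, into the table.\<close>

definition entries :: "complex \<Rightarrow> real \<Rightarrow> real set" where
  "entries d p = {s \<in> U. Im (cnj d * \<gamma> s) = p \<and> Im (cnj d * T s) < 0}"

definition exits :: "complex \<Rightarrow> real \<Rightarrow> real set" where
  "exits d p = {s \<in> U. Im (cnj d * \<gamma> s) = p \<and> Im (cnj d * T s) > 0}"

text \<open>Truncation by \<open>ennreal\<close> makes each weight the absolute slope of the height
  on crossings of one kind and 0 on the others; this is the area formula with \<open>k\<close> cut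
  down to one sign of the slope.\<close>

lemma nn_integral_crossings:
  fixes k :: "real \<Rightarrow> ennreal"
  assumes [measurable]: "k \<in> borel_measurable borel"
  shows "(\<integral>\<^sup>+s. k s * ennreal (- Im (cnj d * T s)) * indicator U s \<partial>lborel) = (\<integral>\<^sup>+p. (\<integral>\<^sup>+s. k s \<partial>count_space (entries d p)) \<partial>lborel)"
    and "(\<integral>\<^sup>+s. k s * ennreal (Im (cnj d * T s)) * indicator U s \<partial>lborel) = (\<integral>\<^sup>+p. (\<integral>\<^sup>+s. k s \<partial>count_space (exits d p)) \<partial>lborel)"
proof -
  let ?h = "\<lambda>s. Im (cnj d * \<gamma> s)" and ?h' = "\<lambda>s. Im (cnj d * T s)"
  have cont: "continuous_on U ?h'" by (intro continuous_intros continuous_on_T)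
  have [measurable]: "?h' \<in> borel_measurable borel" by measurable
  have restrict: "(\<integral>\<^sup>+s. k s * indicator P s \<partial>count_space {s \<in> U. ?h s = p \<and> ?h' s \<noteq> 0}) = (\<integral>\<^sup>+s. k s \<partial>count_space X)"
    if "X = {s \<in> U. ?h s = p \<and> ?h' s \<noteq> 0} \<inter> P" for P X p
  proof -
    have ind: "(\<integral>\<^sup>+s. f s \<partial>count_space Y) = (\<integral>\<^sup>+s. f s * indicator Y s \<partial>count_space UNIV)" for f :: "real \<Rightarrow> ennreal" and Y
      by (rule nn_integral_count_space_indicator) simp
    show ?thesis unfolding that
      by (subst (1 2) ind) (intro nn_integral_cong, simp add: indicator_inter_arith mult_ac)
  qed
  have neg: "(\<lambda>s. k s * indicator {s. ?h' s < 0} s) \<in> borel_measurable borel" by measurable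
  have "(\<integral>\<^sup>+s. k s * ennreal (- ?h' s) * indicator U s \<partial>lborel) = (\<integral>\<^sup>+s. k s * indicator {s. ?h' s < 0} s * ennreal \<bar>?h' s\<bar> * indicator U s \<partial>lborel)"
    by (intro nn_integral_cong) (auto simp del: times_complex.sel split: split_indicator simp: ennreal_neg abs_of_neg not_less)
  also have "\<dots> = (\<integral>\<^sup>+p. (\<integral>\<^sup>+s. k s * indicator {s. ?h' s < 0} s \<partial>count_space {s \<in> U. ?h s = p \<and> ?h' s \<noteq> 0}) \<partial>lborel)"
    by (rule area_formula[OF neg open_U height_derivative cont])
  also have "\<dots> = (\<integral>\<^sup>+p. (\<integral>\<^sup>+s. k s \<partial>count_space (entries d p)) \<partial>lborel)"
    by (intro nn_integral_cong restrict) (auto simp: entries_def)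
  finally show "(\<integral>\<^sup>+s. k s * ennreal (- ?h' s) * indicator U s \<partial>lborel) = (\<integral>\<^sup>+p. (\<integral>\<^sup>+s. k s \<partial>count_space (entries d p)) \<partial>lborel)" .
  have pos: "(\<lambda>s. k s * indicator {s. ?h' s > 0} s) \<in> borel_measurable borel" by measurable
  have "(\<integral>\<^sup>+s. k s * ennreal (?h' s) * indicator U s \<partial>lborel) = (\<integral>\<^sup>+s. k s * indicator {s. ?h' s > 0} s * ennreal \<bar>?h' s\<bar> * indicator U s \<partial>lborel)"
    by (intro nn_integral_cong) (auto simp del: times_complex.sel split: split_indicator simp: ennreal_neg not_less)
  also have "\<dots> = (\<integral>\<^sup>+p. (\<integral>\<^sup>+s. k s * indicator {s. ?h' s > 0} s \<partial>count_space {s \<in> U. ?h s = p \<and> ?h' s \<noteq> 0}) \<partial>lborel)"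
    by (rule area_formula[OF pos open_U height_derivative cont])
  also have "\<dots> = (\<integral>\<^sup>+p. (\<integral>\<^sup>+s. k s \<partial>count_space (exits d p)) \<partial>lborel)"
    by (intro nn_integral_cong restrict) (auto simp: exits_def)
  finally show "(\<integral>\<^sup>+s. k s * ennreal (?h' s) * indicator U s \<partial>lborel) = (\<integral>\<^sup>+p. (\<integral>\<^sup>+s. k s \<partial>count_space (exits d p)) \<partial>lborel)" .
qed

text \<open>The exceptional heights are critical values at smooth points, null by Sard's lemma, and
  the finitely many heights of points of \<open>K\<close>.\<close>

lemma AE_regular: "AE p in lborel. regular d p"
proof -
  let ?h = "\<lambda>s. Im (cnj d * \<gamma> s)"
  define C where "C = {s \<in> U. Im (cnj d * T s) = 0}"
  have "negligible (?h ` C)"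
    by (rule negligible_critical_values) (use height_derivative[of _ d] in \<open>metis (mono_tags, lifting) C_def mem_Collect_eq\<close>)
  moreover have "negligible (?h ` K)" using K by (simp add: negligible_finite)
  ultimately have "negligible (?h ` C \<union> ?h ` K)" by simp
  then obtain N where N: "N \<in> null_sets lborel" "?h ` C \<union> ?h ` K \<subseteq> N"
    unfolding negligible_iff_null_sets null_sets_completion_iff2 by blast
  show ?thesis
  proof (rule AE_I'[OF N(1)])
    have "p \<in> ?h ` C \<union> ?h ` K" if p: "\<not> regular d p" for p
    proof -
      obtain s where s: "s \<in> {0..<L}" "?h s = p" "s \<in> U \<Longrightarrow> Im (cnj d * T s) = 0"
        using p unfolding regular_def by blast
      have "s \<in> C \<or> s \<in> K" using s K by (auto simp: C_def U_def order.order_iff_strict)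
      then show ?thesis using s(2) by blast
    qed
    then show "{p \<in> space lborel. \<not> regular d p} \<subseteq> N" using N(2) by blast
  qed
qed

text \<open>The exits for \<open>d\<close> are the entries for \<open>- d\<close>, so
  \<open>nxt_regular\<close> applied to the opposite direction supplies the inverse.\<close>

lemma bij_nxt:
  assumes d: "norm d = 1" and reg: "regular d p"
  shows "bij_betw (\<lambda>s. nxt s d) (entries d p) (exits d p)"
proof (rule bij_betw_byWitness[where f' = "\<lambda>s. nxt s (- d)"])
  have Im_minus: "Im (cnj (- d) * z) = - Im (cnj d * z)" for z by simp
  have fwd: "nxt s d \<in> exits d p" "nxt (nxt s d) (- d) = s" if "s \<in> entries d p" for s
    using nxt_regular[of s d] that reg d unfolding entries_def exits_def by auto
  have bwd: "nxt s (- d) \<in> entries d p" "nxt (nxt s (- d)) d = s" if "s \<in> exits d p" for s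
  proof -
    have s: "s \<in> U" "Im (cnj d * \<gamma> s) = p" "Im (cnj d * T s) > 0" using that by (auto simp: exits_def)
    have d': "norm (- d) = 1" using d by simp
    have reg': "regular (- d) (Im (cnj (- d) * \<gamma> s))" unfolding Im_minus s(2) regular_minus by (rule reg)
    have "Im (cnj (- d) * T s) < 0" unfolding Im_minus using s(3) by simp
    note n = nxt_regular[OF s(1) d' reg' this, unfolded Im_minus minus_minus]
    show "nxt s (- d) \<in> entries d p" using n(1,2,3) s(2) unfolding entries_def by auto
    show "nxt (nxt s (- d)) d = s" by (rule n(5))
  qed
  show "\<forall>s\<in>entries d p. nxt (nxt s d) (- d) = s" "\<forall>s\<in>exits d p. nxt (nxt s (- d)) d = s"
    "(\<lambda>s. nxt s d) ` entries d p \<subseteq> exits d p" "(\<lambda>s. nxt s (- d)) ` exits d p \<subseteq> entries d p"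
    using fwd bwd by auto
qed

lemma T_cis_Arg:
  assumes "s \<in> U" "norm d = 1"
  shows "T s * cis (Arg (d * cnj (T s))) = d"
proof -
  have "norm (d * cnj (T s)) = 1" using assms norm_T by (simp add: norm_mult)
  then have "cis (Arg (d * cnj (T s))) = d * cnj (T s)" by (subst cis_Arg) (auto simp: sgn_eq)
  moreover have "T s * cnj (T s) = 1" using norm_T[OF assms(1)] by (simp add: complex_norm_square[symmetric])
  ultimately show ?thesis by (metis mult.left_commute mult.right_neutral)
qed

lemma billiard_map_line:
  assumes "s \<in> U" "norm d = 1"
  shows "billiard_map \<gamma> L (s, Arg (d * cnj (T s))) = (nxt s d, Arg (T (nxt s d) * cnj d))"
  by (simp add: billiard_map_eq T_cis_Arg[OF assms])

text \<open>The left side is written with outgoing directions, hence as sums over entries, the right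
  side with incoming ones, as sums over exits. For fixed direction and almost every height,
  \<open>bij_nxt\<close> matches the sums term by term.\<close>

theorem nn_integral_billiard:
  assumes F[measurable]: "F \<in> borel_measurable borel"
  shows "(\<integral>\<^sup>+z. F (billiard_map \<gamma> L z) \<partial>\<nu>) = (\<integral>\<^sup>+z. F z \<partial>\<nu>)"
proof -
  have F'[measurable]: "F \<in> borel_measurable (borel \<Otimes>\<^sub>M borel)" unfolding borel_prod by measurable
  have FB: "(\<lambda>z. F (billiard_map \<gamma> L z)) \<in> borel_measurable borel" by measurable
  have FB'[measurable]: "(\<lambda>z. F (billiard_map \<gamma> L z)) \<in> borel_measurable (borel \<Otimes>\<^sub>M borel)"
    unfolding borel_prod by measurable
  have line: "(\<integral>\<^sup>+s. F (billiard_map \<gamma> L (s, Arg (d * cnj (T s)))) * ennreal (- Im (cnj d * T s)) * indicator U s \<partial>lborel)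
      = (\<integral>\<^sup>+s. F (s, Arg (T s * cnj d)) * ennreal (Im (cnj d * T s)) * indicator U s \<partial>lborel)"
    if d: "norm d = 1" for d
  proof -
    have "(\<lambda>s. F (billiard_map \<gamma> L (s, Arg (d * cnj (T s))))) \<in> borel_measurable borel" by measurable
    then have "(\<integral>\<^sup>+s. F (billiard_map \<gamma> L (s, Arg (d * cnj (T s)))) * ennreal (- Im (cnj d * T s)) * indicator U s \<partial>lborel)
      = (\<integral>\<^sup>+p. (\<integral>\<^sup>+s. F (billiard_map \<gamma> L (s, Arg (d * cnj (T s)))) \<partial>count_space (entries d p)) \<partial>lborel)"
      by (rule nn_integral_crossings)
    \<comment> \<open>The angle after reflection depends only on \<open>d\<close> and the new
      footpoint, so the summand is the exit summand evaluated at \<open>nxt s d\<close>.\<close>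
    also have "\<dots> = (\<integral>\<^sup>+p. (\<integral>\<^sup>+s. F (nxt s d, Arg (T (nxt s d) * cnj d)) \<partial>count_space (entries d p)) \<partial>lborel)"
      by (intro nn_integral_cong) (auto simp: entries_def billiard_map_line d)
    also have "\<dots> = (\<integral>\<^sup>+p. (\<integral>\<^sup>+s. F (s, Arg (T s * cnj d)) \<partial>count_space (exits d p)) \<partial>lborel)"
    proof (rule nn_integral_cong_AE)
      show "AE p in lborel. (\<integral>\<^sup>+s. F (nxt s d, Arg (T (nxt s d) * cnj d)) \<partial>count_space (entries d p))
         = (\<integral>\<^sup>+s. F (s, Arg (T s * cnj d)) \<partial>count_space (exits d p))"
        using AE_regular[of d]
        by eventually_elim (rule nn_integral_bij_count_space[OF bij_nxt[OF d], of _ "\<lambda>s. F (s, Arg (T s * cnj d))"])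
    qed
    also have "\<dots> = (\<integral>\<^sup>+s. F (s, Arg (T s * cnj d)) * ennreal (Im (cnj d * T s)) * indicator U s \<partial>lborel)"
      by (rule nn_integral_crossings[symmetric]) measurable
    finally show ?thesis .
  qed
  show ?thesis
    unfolding nn_integral_\<nu>_lines(1)[OF FB] nn_integral_\<nu>_lines(2)[OF F] line[OF norm_cis] ..
qed

text \<open>The first disintegration, applied to the indicator of the failure set, reduces almost
  everywhere claims to phase points that leave along regular lines.\<close>

lemma AE_\<nu>_lines:
  assumes [measurable]: "Measurable.pred borel P"
    and P: "\<And>d p s. norm d = 1 \<Longrightarrow> regular d p \<Longrightarrow> s \<in> entries d p \<Longrightarrow> P (s, Arg (d * cnj (T s)))"
  shows "AE z in \<nu>. P z"
proof -
  have [measurable]: "Measurable.pred (borel \<Otimes>\<^sub>M borel) P" unfolding borel_prod by measurable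
  define F :: "real \<times> real \<Rightarrow> ennreal" where "F = indicator {z. \<not> P z}"
  have F[measurable]: "F \<in> borel_measurable borel" unfolding F_def by measurable
  have F'[measurable]: "F \<in> borel_measurable (borel \<Otimes>\<^sub>M borel)" unfolding borel_prod by measurable
  have line: "(\<integral>\<^sup>+s. F (s, Arg (d * cnj (T s))) * ennreal (- Im (cnj d * T s)) * indicator U s \<partial>lborel) = 0"
    if d: "norm d = 1" for d
  proof -
    have "(\<integral>\<^sup>+s. F (s, Arg (d * cnj (T s))) * ennreal (- Im (cnj d * T s)) * indicator U s \<partial>lborel)
      = (\<integral>\<^sup>+p. (\<integral>\<^sup>+s. F (s, Arg (d * cnj (T s))) \<partial>count_space (entries d p)) \<partial>lborel)"
      by (rule nn_integral_crossings) measurable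
    also have "\<dots> = (\<integral>\<^sup>+p. 0 \<partial>(lborel :: real measure))"
    proof (rule nn_integral_cong_AE)
      show "AE p in lborel. (\<integral>\<^sup>+s. F (s, Arg (d * cnj (T s))) \<partial>count_space (entries d p)) = 0"
        using AE_regular[of d]
      proof eventually_elim
        fix p assume "regular d p"
        then have "(\<integral>\<^sup>+s. F (s, Arg (d * cnj (T s))) \<partial>count_space (entries d p)) = (\<integral>\<^sup>+s. 0 \<partial>count_space (entries d p))"
          by (intro nn_integral_cong) (use P d in \<open>auto simp: F_def\<close>)
        then show "(\<integral>\<^sup>+s. F (s, Arg (d * cnj (T s))) \<partial>count_space (entries d p)) = 0" by simp
      qed
    qed
    finally show ?thesis by simp
  qed
  have "(\<integral>\<^sup>+z. F z \<partial>\<nu>) = 0" unfolding nn_integral_\<nu>_lines(1)[OF F] line[OF norm_cis] by simp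
  then have "AE z in \<nu>. F z = 0" by (subst (asm) nn_integral_0_iff_AE) auto
  then show ?thesis by (auto simp: F_def split: split_indicator_asm)
qed

end

section \<open>The rotation number\<close>

context billiard_table
begin

lemma measure_preserving_\<nu>I:
  assumes fin: "finite_measure \<nu>" and [measurable]: "\<phi> \<in> borel_measurable borel"
    and eq: "\<And>F. F \<in> borel_measurable borel \<Longrightarrow> (\<integral>\<^sup>+z. F (\<phi> z) \<partial>\<nu>) = (\<integral>\<^sup>+z. F z \<partial>\<nu>)"
  shows "measure_preserving_map \<nu> \<phi>"
proof -
  interpret finite_measure \<nu> by fact
  have meas: "\<phi> \<in> measurable \<nu> \<nu>" by measurable
  have "distr \<nu> \<nu> \<phi> = \<nu>"
  proof (rule measure_eqI)
    fix A assume A: "A \<in> sets (distr \<nu> \<nu> \<phi>)"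
    then have A': "A \<in> sets \<nu>" by simp
    have "emeasure (distr \<nu> \<nu> \<phi>) A = (\<integral>\<^sup>+z. indicator A z \<partial>distr \<nu> \<nu> \<phi>)"
      using A by simp
    also have "\<dots> = (\<integral>\<^sup>+z. indicator A (\<phi> z) \<partial>\<nu>)"
      using A' by (intro nn_integral_distr meas) simp
    also have "\<dots> = emeasure \<nu> A" using A' by (subst eq) auto
    finally show "emeasure (distr \<nu> \<nu> \<phi>) A = emeasure \<nu> A" .
  qed simp
  then show ?thesis using meas by unfold_locales
qed

lemma emeasure_\<nu>_UNIV: "emeasure \<nu> UNIV = ennreal (2 * L)"
proof -
  have "(\<integral>\<^sup>+\<theta>. ennreal (sin \<theta>) * indicator {0..pi} \<theta> \<partial>lborel) = ennreal (- cos pi - (- cos 0))"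
    by (rule nn_integral_FTC_Icc[where F = "\<lambda>\<theta>. - cos \<theta>"])
      (auto intro!: derivative_eq_intros sin_ge_zero)
  then have sin: "(\<integral>\<^sup>+\<theta>. 1 * ennreal (sin \<theta>) * indicator {0..pi} \<theta> \<partial>lborel) = 2" by simp
  have "emeasure \<nu> UNIV = (\<integral>\<^sup>+z. 1 \<partial>\<nu>)" by simp
  also have "\<dots> = 2 * ennreal L"
    by (subst nn_integral_\<nu>) (use L_pos in \<open>simp_all add: sin[simplified] nn_integral_cmult\<close>)
  finally show ?thesis by (simp add: ennreal_mult')
qed

lemma finite_\<nu>: "finite_measure \<nu>"
  by (rule finite_measureI) (simp add: emeasure_\<nu>_UNIV)

sublocale dyn: measure_preserving_map \<nu> "billiard_map \<gamma> L"
  by (rule measure_preserving_\<nu>I[OF finite_\<nu> billiard_map_meas nn_integral_billiard])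

section \<open>Time reversal and its effect on the rotation number\<close>

definition flip :: "real \<times> real \<Rightarrow> real \<times> real" where
  "flip z = (fst z, pi - snd z)"

lemma flip_meas[measurable]: "flip \<in> borel_measurable borel"
  unfolding flip_def[abs_def] borel_prod[symmetric] by measurable

lemma nn_integral_flip:
  assumes F[measurable]: "F \<in> borel_measurable borel"
  shows "(\<integral>\<^sup>+z. F (flip z) \<partial>\<nu>) = (\<integral>\<^sup>+z. F z \<partial>\<nu>)"
proof -
  have F'[measurable]: "F \<in> borel_measurable (borel \<Otimes>\<^sub>M borel)" unfolding borel_prod by measurable
  have FF: "(\<lambda>z. F (flip z)) \<in> borel_measurable borel" by measurable
  have inner: "(\<integral>\<^sup>+\<theta>. F (flip (s, \<theta>)) * ennreal (sin \<theta>) * indicator {0..pi} \<theta> \<partial>lborel) =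
      (\<integral>\<^sup>+\<theta>. F (s, \<theta>) * ennreal (sin \<theta>) * indicator {0..pi} \<theta> \<partial>lborel)" for s
  proof -
    have "(\<integral>\<^sup>+\<theta>. F (s, \<theta>) * ennreal (sin \<theta>) * indicator {0..pi} \<theta> \<partial>lborel) =
       (\<integral>\<^sup>+\<theta>. F (s, pi - \<theta>) * ennreal (sin (pi - \<theta>)) * indicator {0..pi} (pi - \<theta>) \<partial>lborel)"
      by (subst nn_integral_real_affine[of _ "-1" pi]) auto
    also have "\<dots> = (\<integral>\<^sup>+\<theta>. F (flip (s, \<theta>)) * ennreal (sin \<theta>) * indicator {0..pi} \<theta> \<partial>lborel)"
      by (intro nn_integral_cong) (auto simp: flip_def split: split_indicator)
    finally show ?thesis ..
  qed
  show ?thesis unfolding nn_integral_\<nu>[OF FF] nn_integral_\<nu>[OF F] inner ..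
qed

sublocale flip: measure_preserving_map \<nu> flip
  by (rule measure_preserving_\<nu>I[OF finite_\<nu> flip_meas nn_integral_flip])

text \<open>The footpoint step in units of the perimeter: its values lie in the unit interval and
  its Birkhoff limit is the rotation number itself.\<close>

definition winding_step :: "real \<times> real \<Rightarrow> real" where
  "winding_step z = frac ((fst (billiard_map \<gamma> L z) - fst z) / L)"

lemma winding_step_meas[measurable]: "winding_step \<in> borel_measurable borel"
proof -
  have [measurable]: "fst \<in> borel_measurable (borel :: (real \<times> real) measure)"
    unfolding borel_prod[symmetric] by measurable
  show ?thesis unfolding winding_step_def[abs_def] frac_def by measurable
qed

lemma winding_step_range: "0 \<le> winding_step z" "winding_step z \<le> 1"
  by (simp_all add: winding_step_def frac_lt_1 less_imp_le)

lemma rotation_number_eq: "rotation_number \<gamma> L = dyn.birkhoff_limit winding_step"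
proof
  fix z
  have avg: "gain_average \<gamma> L z = (\<lambda>n. L * birkhoff_avg (billiard_map \<gamma> L) winding_step n z)"
    by (intro ext) (simp only: gain_average_def birkhoff_avg_def footpoint_step_def winding_step_def
        sum_distrib_left[symmetric] times_divide_eq_right)
  have conv: "convergent (gain_average \<gamma> L z) \<longleftrightarrow> convergent (\<lambda>n. birkhoff_avg (billiard_map \<gamma> L) winding_step n z)"
    unfolding avg using L_pos by (simp add: convergent_mult_const_iff)
  have "lim (gain_average \<gamma> L z) = L * lim (\<lambda>n. birkhoff_avg (billiard_map \<gamma> L) winding_step n z)"
    if "convergent (\<lambda>n. birkhoff_avg (billiard_map \<gamma> L) winding_step n z)"
    using that unfolding avg convergent_LIMSEQ_iff by (intro limI tendsto_mult tendsto_const)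
  then show "rotation_number \<gamma> L z = dyn.birkhoff_limit winding_step z"
    using L_pos by (simp add: rotation_number_def dyn.birkhoff_limit_def conv)
qed

text \<open>Reversing a ray amounts to reflection in the imaginary axis once the tangent is turned
  to the real axis. Strict positivity keeps both angles away from the branch cut of
  \<open>Arg\<close>.\<close>

lemma Arg_minus_cnj:
  assumes "Im u > 0"
  shows "Arg (- cnj u) = pi - Arg u"
proof -
  have u: "u \<noteq> 0" and a: "0 < Arg u" "Arg u < pi" using assms Arg_lt_pi[of u] by auto
  have "- cnj u = rcis (norm u) (pi - Arg u)"
    by (subst (1) rcis_cmod_Arg[of u, symmetric]) (simp add: complex_eq_iff)
  then show ?thesis using u a by (simp add: Arg_rcis)
qed

text \<open>Flipping after the hit at \<open>s'\<close> gives the phase point at \<open>s'\<close>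
  with direction \<open>- d\<close>, whose ray returns to \<open>s\<close>. The chord is then
  traversed backwards, and the two boundary arcs between its ends make up one perimeter.\<close>

lemma flip_line:
  assumes z: "norm d = 1" "regular d p" "s \<in> entries d p"
  shows "billiard_map \<gamma> L (flip (billiard_map \<gamma> L (s, Arg (d * cnj (T s))))) = flip (s, Arg (d * cnj (T s)))"
    and "winding_step (flip (billiard_map \<gamma> L (s, Arg (d * cnj (T s))))) = 1 - winding_step (s, Arg (d * cnj (T s)))"
proof -
  have s: "s \<in> U" "Im (cnj d * \<gamma> s) = p" "Im (cnj d * T s) < 0" using z by (auto simp: entries_def)
  define s' where "s' = nxt s d"
  have s': "s' \<in> U" "Im (cnj d * T s') > 0" "s' \<noteq> s" "nxt s' (- d) = s"
    using nxt_regular[of s d] s z unfolding s'_def by auto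
  have d': "norm (- d) = 1" using z by simp
  have pos: "Im (T s' * cnj d) > 0" using s'(2) by (simp only: mult.commute)
  have pos': "Im (d * cnj (T s)) > 0" using s(3) unfolding Im_mult_cnj_commute by simp
  have map: "billiard_map \<gamma> L (s, Arg (d * cnj (T s))) = (s', Arg (T s' * cnj d))"
    unfolding s'_def by (rule billiard_map_line[OF s(1) z(1)])
  have fl: "flip (s', Arg (T s' * cnj d)) = (s', Arg (- d * cnj (T s')))"
    using Arg_minus_cnj[OF pos] by (simp add: flip_def mult.commute)
  have map': "billiard_map \<gamma> L (s', Arg (- d * cnj (T s'))) = (s, Arg (T s * cnj (- d)))"
    using billiard_map_line[OF s'(1) d'] s'(4) by simp
  show "billiard_map \<gamma> L (flip (billiard_map \<gamma> L (s, Arg (d * cnj (T s))))) = flip (s, Arg (d * cnj (T s)))"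
    unfolding map fl map' using Arg_minus_cnj[OF pos'] by (simp add: flip_def mult.commute)
  \<comment> \<open>The ends are distinct and less than \<open>L\<close> apart, so the quotient is
    not an integer; at an integer both fractional parts would be 0 and not add up to 1.\<close>
  have "\<bar>s' - s\<bar> < L" using s(1) s'(1) by (auto simp: U_def)
  then have "\<bar>(s' - s) / L\<bar> < 1" using L_pos by simp
  moreover have "(s' - s) / L \<noteq> 0" using s'(3) L_pos by simp
  ultimately have "(s' - s) / L \<notin> \<int>" using Ints_nonzero_abs_ge1 by (metis not_less)
  then have "frac ((s - s') / L) = 1 - frac ((s' - s) / L)"
    using frac_neg[of "(s' - s) / L"] by (simp add: minus_divide_left)
  then show "winding_step (flip (billiard_map \<gamma> L (s, Arg (d * cnj (T s))))) = 1 - winding_step (s, Arg (d * cnj (T s)))"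
    unfolding winding_step_def map fl map' by simp
qed

lemma AE_reversal:
  "AE z in \<nu>. rotation_number \<gamma> L (flip z) = 1 - rotation_number \<gamma> L z"
  unfolding rotation_number_eq
proof (rule dyn.birkhoff_limit_reversal[OF flip.measure_preserving_map_axioms])
  show "AE z in \<nu>. billiard_map \<gamma> L (flip (billiard_map \<gamma> L z)) = flip z"
    by (rule AE_\<nu>_lines) (measurable, rule flip_line(1))
  show "AE z in \<nu>. winding_step (flip (billiard_map \<gamma> L z)) = 1 - winding_step z"
    by (rule AE_\<nu>_lines) (measurable, rule flip_line(2))
qed (use winding_step_range in auto)

lemma rotation_number_meas[measurable]: "rotation_number \<gamma> L \<in> borel_measurable borel"
  using dyn.birkhoff_limit_meas[of winding_step] unfolding rotation_number_eq by simp

lemma rotation_number_range: "rotation_number \<gamma> L z \<in> {0..1}"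
  unfolding rotation_number_eq by (rule dyn.birkhoff_limit_range) (rule winding_step_range)+

lemma emeasure_rotation_reversal:
  assumes [measurable]: "X \<in> sets borel"
  shows "emeasure \<nu> {z. rotation_number \<gamma> L z \<in> X} = emeasure \<nu> {z. 1 - rotation_number \<gamma> L z \<in> X}"
proof -
  have "emeasure \<nu> {z. rotation_number \<gamma> L z \<in> X} = (\<integral>\<^sup>+z. indicator {z. rotation_number \<gamma> L z \<in> X} z \<partial>\<nu>)"
    by (subst nn_integral_indicator) auto
  also have "\<dots> = (\<integral>\<^sup>+z. indicator {z. rotation_number \<gamma> L z \<in> X} (flip z) \<partial>\<nu>)"
    by (rule nn_integral_flip[symmetric]) measurable
  also have "\<dots> = (\<integral>\<^sup>+z. indicator {z. 1 - rotation_number \<gamma> L z \<in> X} z \<partial>\<nu>)"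
    by (rule nn_integral_cong_AE) (use AE_reversal in \<open>eventually_elim, simp add: indicator_def\<close>)
  also have "\<dots> = emeasure \<nu> {z. 1 - rotation_number \<gamma> L z \<in> X}"
    by (subst nn_integral_indicator) auto
  finally show ?thesis .
qed

text \<open>By reversal the integral equals the total mass \<open>2 * L\<close> minus
  itself.\<close>

lemma integral_rotation_number: "(\<integral>z. rotation_number \<gamma> L z \<partial>\<nu>) = L"
proof -
  let ?r = "rotation_number \<gamma> L"
  have int: "integrable \<nu> ?r"
    by (rule dyn.integrable_const_bound[of _ 1]) (use rotation_number_range in auto)
  have "(\<integral>z. ?r z \<partial>\<nu>) = (\<integral>z. ?r (flip z) \<partial>\<nu>)"
    by (rule flip.integral_comp[symmetric]) measurable
  also have "\<dots> = (\<integral>z. 1 - ?r z \<partial>\<nu>)"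
    by (rule integral_cong_AE) (measurable, rule AE_reversal)
  also have "\<dots> = measure \<nu> UNIV - (\<integral>z. ?r z \<partial>\<nu>)"
    by (subst Bochner_Integration.integral_diff) (use int in auto)
  also have "measure \<nu> UNIV = 2 * L" using L_pos by (simp add: measure_def emeasure_\<nu>_UNIV)
  finally show ?thesis by simp
qed

section \<open>Transfer to the Liouville measure and the ergodic case\<close>

lemma space_liouville[simp]: "space (liouville L) = phase_space L"
  by (simp add: liouville_def space_restrict_space)

lemma sets_liouvilleI: "A \<in> sets borel \<Longrightarrow> A \<inter> phase_space L \<in> sets (liouville L)"
  unfolding liouville_def sets_density sets_restrict_space
  by (rule image_eqI[of _ _ A]) (simp_all add: Int_commute sets_completionI_sets)

lemma measurable_liouville: "F \<in> borel_measurable borel \<Longrightarrow> F \<in> borel_measurable (liouville L)"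
  by (auto simp: liouville_def intro!: measurable_restrict_space1 borel_measurable_if_I measurable_completion)

text \<open>\<open>liouville\<close> is built on completed Lebesgue measure; for Borel integrands
  the completion does not change the integral.\<close>

lemma nn_integral_liouville:
  assumes F[measurable]: "F \<in> borel_measurable borel"
  shows "(\<integral>\<^sup>+z. F z \<partial>liouville L) = (\<integral>\<^sup>+z. F z \<partial>\<nu>)"
proof -
  have sin[measurable]: "(\<lambda>z :: real \<times> real. ennreal (sin (snd z))) \<in> borel_measurable borel"
    unfolding borel_prod[symmetric] by measurable
  have leb: "G \<in> borel_measurable lebesgue" if "G \<in> borel_measurable borel" for G :: "real \<times> real \<Rightarrow> ennreal"
    using that by (intro measurable_completion) simp
  have "(\<integral>\<^sup>+z. F z \<partial>liouville L) = (\<integral>\<^sup>+z. ennreal (sin (snd z)) * F z \<partial>restrict_space lebesgue (phase_space L))"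
    unfolding liouville_def
    by (intro nn_integral_density measurable_restrict_space1 leb F sin)
  also have "\<dots> = (\<integral>\<^sup>+z. ennreal (sin (snd z)) * F z * indicator (phase_space L) z \<partial>lebesgue)"
    by (rule nn_integral_restrict_space) auto
  also have "\<dots> = (\<integral>\<^sup>+z. ennreal (sin (snd z)) * F z * indicator (phase_space L) z \<partial>lborel)"
    by (rule nn_integral_completion)
  also have "\<dots> = (\<integral>\<^sup>+z. F z \<partial>\<nu>)"
    unfolding \<nu>_def by (subst nn_integral_density) (auto intro!: nn_integral_cong simp: mult_ac)
  finally show ?thesis .
qed

lemma emeasure_liouville:
  assumes A: "A \<in> sets borel"
  shows "emeasure (liouville L) (A \<inter> phase_space L) = emeasure \<nu> A"
proof -
  have "emeasure (liouville L) (A \<inter> phase_space L) = (\<integral>\<^sup>+z. indicator (A \<inter> phase_space L) z \<partial>liouville L)"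
    using sets_liouvilleI[OF A] by simp
  also have "\<dots> = (\<integral>\<^sup>+z. indicator A z \<partial>liouville L)"
    by (intro nn_integral_cong) (auto split: split_indicator)
  also have "\<dots> = emeasure \<nu> A"
    using A by (simp add: nn_integral_liouville)
  finally show ?thesis .
qed

text \<open>\<nu> is concentrated on the phase space and invariant, so leaving it at any time is a
  null event. This provides the exactly invariant subset used for ergodicity.\<close>

lemma AE_orbit_in_phase_space: "AE z in \<nu>. \<forall>k. (billiard_map \<gamma> L ^^ k) z \<in> phase_space L"
proof (rule dyn.AE_iterates)
  have "(\<lambda>z. ennreal (sin (snd z)) * indicator (phase_space L) z) \<in> borel_measurable borel"
  proof -
    have [measurable]: "phase_space L \<in> sets (borel \<Otimes>\<^sub>M borel)" unfolding borel_prod by measurable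
    show ?thesis unfolding borel_prod[symmetric] by measurable
  qed
  then show "AE z in \<nu>. z \<in> phase_space L"
    unfolding \<nu>_def by (subst AE_density) (auto split: split_indicator)
qed

text \<open>The sets where the rotation number lies below and above 1/2 have the same measure by
  reversal, while ergodicity makes one of them null; hence both are. Level sets are first
  intersected with \<open>Orb\<close>, since \<open>ergodic\<close> speaks of exactly invariant
  subsets of the phase space.\<close>

lemma ergodic_rotation_number:
  assumes erg: "ergodic (liouville L) (billiard_map \<gamma> L)"
  shows "AE z in liouville L. rotation_number \<gamma> L z = 1 / 2"
proof -
  let ?r = "rotation_number \<gamma> L" and ?\<phi> = "billiard_map \<gamma> L"
  define Orb where "Orb = {z. \<forall>k. (?\<phi> ^^ k) z \<in> phase_space L}"
  have pow[measurable]: "(?\<phi> ^^ k) \<in> borel_measurable borel" for k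
    using dyn.pow_meas[of k] by simp
  have Orb[measurable]: "Orb \<in> sets borel" unfolding Orb_def by measurable
  have OAE: "AE z in \<nu>. z \<in> Orb" using AE_orbit_in_phase_space by (simp add: Orb_def)
  have sub: "Orb \<subseteq> phase_space L" unfolding Orb_def by (auto dest: spec[of _ 0])
  \<comment> \<open>Splitting off time 0 shows that \<open>Orb\<close> is its own preimage within
    the phase space.\<close>
  have shift: "z \<in> Orb \<longleftrightarrow> z \<in> phase_space L \<and> ?\<phi> z \<in> Orb" for z
  proof -
    have "(\<forall>k. (?\<phi> ^^ k) z \<in> phase_space L) \<longleftrightarrow> (?\<phi> ^^ 0) z \<in> phase_space L \<and> (\<forall>k. (?\<phi> ^^ Suc k) z \<in> phase_space L)"
      by (metis not0_implies_Suc)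
    then show ?thesis by (simp add: Orb_def funpow_swap1)
  qed
  have bound: "\<bar>winding_step z\<bar> \<le> 1" for z using winding_step_range[of z] by simp
  have inv: "?r (?\<phi> z) = ?r z" for z
    unfolding rotation_number_eq by (rule dyn.birkhoff_limit_shift[of _ 1, OF bound])
  have meas: "emeasure \<nu> (Orb \<inter> {z. ?r z \<in> X}) = emeasure \<nu> {z. ?r z \<in> X}" if [measurable]: "X \<in> sets borel" for X
    by (rule emeasure_eq_AE) (use OAE in auto)
  have dich: "emeasure \<nu> {z. ?r z \<in> X} = 0 \<or> emeasure \<nu> {z. ?r z \<in> Y} = 0"
    if [measurable]: "X \<in> sets borel" "Y \<in> sets borel" and XY: "X \<inter> Y = {}" for X Y
  proof -
    define A where "A = Orb \<inter> {z. ?r z \<in> X}"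
    have A[measurable]: "A \<in> sets borel" unfolding A_def by measurable
    have eqA: "A \<inter> phase_space L = A" using sub by (auto simp: A_def)
    have "?\<phi> -` A \<inter> space (liouville L) = A"
      using shift inv by (auto simp: A_def)
    moreover have "A \<in> sets (liouville L)" using sets_liouvilleI[OF A] eqA by simp
    ultimately have "emeasure (liouville L) A = 0 \<or> emeasure (liouville L) (phase_space L - A) = 0"
      using erg unfolding ergodic_def by auto
    moreover have "emeasure (liouville L) A = emeasure \<nu> A" using emeasure_liouville[OF A] eqA by simp
    moreover have "emeasure (liouville L) (phase_space L - A) = emeasure \<nu> (- A)"
      using emeasure_liouville[of "- A"] A by (simp add: Diff_eq Int_commute)
    \<comment> \<open>Disjoint level sets: if the one for \<open>X\<close> has null complement, the
      one for \<open>Y\<close> is contained in a null set.\<close>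
    moreover have "emeasure \<nu> {z. ?r z \<in> Y} \<le> emeasure \<nu> (- A)"
      by (rule emeasure_mono) (use XY in \<open>auto simp: A_def\<close>)
    ultimately show ?thesis using meas[of X] by (auto simp: A_def)
  qed
  have "{z. 1 - ?r z \<in> {..<1/2}} = {z. ?r z \<in> {1/2<..}}" by auto
  then have "emeasure \<nu> {z. ?r z \<in> {..<1/2}} = emeasure \<nu> {z. ?r z \<in> {1/2<..}}"
    using emeasure_rotation_reversal[of "{..<1/2}"] by simp
  moreover have lr: "{..<1/2} \<inter> {1/2<..} = ({} :: real set)" by auto
  ultimately have "emeasure \<nu> {z. ?r z \<in> {..<1/2}} = 0" "emeasure \<nu> {z. ?r z \<in> {1/2<..}} = 0"
    using dich[OF _ _ lr] by simp_all
  then have "emeasure (liouville L) ({z. ?r z \<in> {..<1/2}} \<inter> phase_space L) = 0"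
    "emeasure (liouville L) ({z. ?r z \<in> {1/2<..}} \<inter> phase_space L) = 0"
    by (subst emeasure_liouville; simp)+
  then have "{z. ?r z \<in> {..<1/2}} \<inter> phase_space L \<in> null_sets (liouville L)"
    "{z. ?r z \<in> {1/2<..}} \<inter> phase_space L \<in> null_sets (liouville L)"
    by (intro null_setsI sets_liouvilleI; measurable)+
  then have "AE z in liouville L. z \<notin> {z. ?r z \<in> {..<1/2}} \<inter> phase_space L"
    "AE z in liouville L. z \<notin> {z. ?r z \<in> {1/2<..}} \<inter> phase_space L"
    using AE_not_in by blast+
  then show ?thesis using AE_space
  proof eventually_elim
    fix z assume "z \<notin> {z. ?r z \<in> {..<1/2}} \<inter> phase_space L" "z \<notin> {z. ?r z \<in> {1/2<..}} \<inter> phase_space L"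
      and "z \<in> space (liouville L)"
    then have "\<not> ?r z < 1 / 2" "\<not> ?r z > 1 / 2" unfolding space_liouville by blast+
    then show "?r z = 1 / 2" by linarith
  qed
qed

end

theorem theorem2p3:
  fixes \<Omega> :: "complex set" and \<gamma> :: "real \<Rightarrow> complex" and L :: real
  assumes "open \<Omega>" and "bounded \<Omega>" and "connected \<Omega>" and "simply_connected \<Omega>"
    and "piecewise_smooth_arclength \<gamma> L"
    and "inj_on \<gamma> {0..<L}"
    and "frontier \<Omega> = \<gamma> ` {0..L}"
    and "\<forall>w\<in>\<Omega>. winding_number (boundary_path \<gamma> L) w = 1"
  shows
    "(\<forall>X. X \<in> sets borel \<and> X \<subseteq> {0..1} \<longrightarrow>
        rotation_number \<gamma> L -` X \<inter> space (liouville L) \<in> sets (liouville L) \<and>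
        rotation_number \<gamma> L -` ((\<lambda>x. 1 - x) ` X) \<inter> space (liouville L) \<in> sets (liouville L) \<and>
        emeasure (liouville L) (rotation_number \<gamma> L -` X \<inter> space (liouville L)) =
        emeasure (liouville L) (rotation_number \<gamma> L -` ((\<lambda>x. 1 - x) ` X) \<inter> space (liouville L)))
     \<and> (integral\<^sup>L (liouville L) (rotation_number \<gamma> L)) / measure (liouville L) (space (liouville L)) = 1 / 2
     \<and> (ergodic (liouville L) (billiard_map \<gamma> L) \<longrightarrow>
          (AE z in liouville L. rotation_number \<gamma> L z = 1 / 2))"
proof -
  obtain K where K: "L > 0" "\<forall>s. \<gamma> (s + L) = \<gamma> s" "finite K" "0 \<in> K" "L \<in> K" "K \<subseteq> {0..L}"
    "\<forall>a\<in>K. \<forall>b\<in>K. a < b \<and> {a<..<b} \<inter> K = {} \<longrightarrow>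
       (\<exists>g. smooth_real_fun g \<and> (\<forall>s\<in>{a..b}. \<gamma> s = g s \<and> norm (vector_derivative g (at s)) = 1))"
    using assms(5) unfolding piecewise_smooth_arclength_def by blast
  interpret billiard_table \<gamma> L K \<Omega>
    by unfold_locales (use assms K in auto)
  let ?r = "rotation_number \<gamma> L"
  have part1: "?r -` X \<inter> space (liouville L) \<in> sets (liouville L) \<and>
        ?r -` ((\<lambda>x. 1 - x) ` X) \<inter> space (liouville L) \<in> sets (liouville L) \<and>
        emeasure (liouville L) (?r -` X \<inter> space (liouville L)) =
        emeasure (liouville L) (?r -` ((\<lambda>x. 1 - x) ` X) \<inter> space (liouville L))"
    if X[measurable]: "X \<in> sets borel" for X
  proof -
    have img: "?r -` ((\<lambda>x. 1 - x) ` X) = {z. 1 - ?r z \<in> X}"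
    proof -
      \<comment> \<open>The reflection is an involution, so the image of \<open>X\<close> is also
        its preimage.\<close>
      have "y \<in> (\<lambda>x. 1 - x) ` X \<longleftrightarrow> 1 - y \<in> X" for y by (auto intro: image_eqI[of _ _ "1 - y"])
      then show ?thesis by blast
    qed
    have pre: "?r -` X = {z. ?r z \<in> X}" by auto
    have m: "{z. ?r z \<in> X} \<in> sets borel" "{z. 1 - ?r z \<in> X} \<in> sets borel" by measurable
    show ?thesis
      unfolding img pre space_liouville emeasure_liouville[OF m(1)] emeasure_liouville[OF m(2)]
      using m emeasure_rotation_reversal[OF X] by (auto intro: sets_liouvilleI)
  qed
  have "measure (liouville L) (space (liouville L)) = 2 * L"
    using emeasure_liouville[of UNIV] L_pos by (simp add: measure_def emeasure_\<nu>_UNIV)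
  \<comment> \<open>The rotation number is nonnegative, so both integrals are read off from
    nonnegative integrals, for which the transfer is known.\<close>
  moreover have "integral\<^sup>L (liouville L) ?r = integral\<^sup>L \<nu> ?r"
    using rotation_number_range
    by (simp add: integral_eq_nn_integral measurable_liouville nn_integral_liouville)
  ultimately have part2: "integral\<^sup>L (liouville L) ?r / measure (liouville L) (space (liouville L)) = 1 / 2"
    using integral_rotation_number L_pos by simp
  show ?thesis using part1 part2 ergodic_rotation_number by blast
qed

end
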